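(* Let $\alpha$ be an irrational real number with continued fraction representation $\alpha=[a_0;a_1,a_2,\dots]$, and suppose there is a constant $d\ge 0$ such that $a_k=O(k^d)$. For a positive integer $n$ let \[A=A(n,\alpha)=\left\{\left(\{\pm k\alpha\},\tfrac{k}{n}\right):1\le k\le n\right\}\subset[0,1]^2\] (a set of $2n$ points), and for $x,y\in[0,1]$ let $S_A(x,y)=|A\cap([0,x)\times[0,y))|$. Then, as $n\to\infty$, \[\int_0^1\!\!\int_0^1\left(S_A(x,y)-|A|xy\right)^2\,\mathrm{d}x\,\mathrm{d}y=\sum_{m=1}^n\frac{1}{4\pi^4 m^2\|m\alpha\|^2}+O\left(\log^{2d}n\,\log\log n\right),\] where the implied constant depends only on $\alpha$.
   Context: $\{x\}$ denotes the fractional part of $x$, and $\|x\|$ denotes the distance from $x$ to the nearest integer. The set $A$ consists of the points $(\{k\alpha\},k/n)$ and $(\{-k\alpha\},k/n)$ for $1\le k\le n$, so $|A|=2n$. *)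

theory Defs
  imports "HOL-Analysis.Analysis" "HOL-Library.Landau_Symbols"
begin

text \<open>
  Continued fraction expansion by the floor algorithm: the complete quotients are
  \<open>\<alpha>\<^sub>0 = \<alpha>\<close>, \<open>\<alpha>\<^sub>k\<^sub>+\<^sub>1 = 1 / {\<alpha>\<^sub>k}\<close>, and the partial quotients are
  \<open>a\<^sub>k = \<lfloor>\<alpha>\<^sub>k\<rfloor>\<close>.  For irrational \<open>\<alpha>\<close> no division by zero ever occurs.
\<close>

primrec complete_quotient :: "real \<Rightarrow> nat \<Rightarrow> real" where
  "complete_quotient \<alpha> 0 = \<alpha>"
| "complete_quotient \<alpha> (Suc k) = 1 / frac (complete_quotient \<alpha> k)"

definition partial_quotient :: "real \<Rightarrow> nat \<Rightarrow> int" where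
  "partial_quotient \<alpha> k = \<lfloor>complete_quotient \<alpha> k\<rfloor>"

definition dist_nearest_int :: "real \<Rightarrow> real" where
  "dist_nearest_int x = \<bar>x - of_int (round x)\<bar>"

definition sym_points :: "nat \<Rightarrow> real \<Rightarrow> (real \<times> real) set" where
  "sym_points n \<alpha> =
     {(frac (real k * \<alpha>), real k / real n) | k. 1 \<le> k \<and> k \<le> n} \<union>
     {(frac (- (real k * \<alpha>)), real k / real n) | k. 1 \<le> k \<and> k \<le> n}"

definition box_count :: "(real \<times> real) set \<Rightarrow> real \<Rightarrow> real \<Rightarrow> nat" where
  "box_count A x y = card (A \<inter> ({0..<x} \<times> {0..<y}))"

definition L2_discrepancy_sq :: "(real \<times> real) set \<Rightarrow> real" where
  "L2_discrepancy_sq A =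
     (LBINT y:{0..1}. (LBINT x:{0..1}. (real (box_count A x y) - real (card A) * x * y)\<^sup>2))"

end

theory Submission
  imports Defs
begin

text \<open>
  Because the points come in pairs \<open>u, 1 - u\<close>, the discrepancy on the strip
  \<open>N/n < y \<le> (N+1)/n\<close> is a sum of symmetrised sawtooth functions of \<open>x\<close> without constant term,
  up to the term \<open>2x(N - ny)\<close>.  Integrating its square and inserting the Fourier series of the second
  Bernoulli polynomial gives the exact formula: the integral equals
  \<open>4/9 + \<Sum>\<^sub>m (V\<^sub>m - 1) / (2\<pi>\<^sup>2m\<^sup>2)\<close>, where \<open>V\<^sub>m\<close> is the mean over \<open>N < n\<close> of the squared Dirichlet kernels
  \<open>(sin ((2N+1)\<pi>m\<alpha>) / sin (\<pi>m\<alpha>))\<^sup>2\<close>.  Replacing \<open>sin\<^sup>2\<close> in the numerator by its mean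
  \<open>1/2\<close> produces the main term.

  The partial quotients enter only through the bound \<open>\<parallel>m\<alpha>\<parallel> \<ge> 1 / (m\<Lambda>)\<close> for \<open>m \<le> 2n\<close> with
  \<open>\<Lambda> = C log\<^sup>d n\<close>.  It makes the multiples of \<open>\<alpha>\<close> well spaced, so that each dyadic block of indices
  \<open>M \<le> m < 2M\<close> contributes at most \<open>12 \<Lambda>\<^sup>2 min(1, 2M\<Lambda>/n)\<close> to the error, and only about
  \<open>log \<Lambda>\<close> dyadic blocks are not geometrically damped.  The terms with \<open>m > n\<close> contribute
  \<open>O(\<Lambda>\<^sup>2)\<close> by the same spacing argument on blocks of length \<open>n\<close>.
\<close>

subsection \<open>Continued fractions and best approximation\<close>

text \<open>
  The index is shifted by one: \<open>convergent_num \<alpha> (k + 1) / convergent_denom \<alpha> (k + 1)\<close> is the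
  convergent \<open>[a\<^sub>0; a\<^sub>1, \<dots>, a\<^sub>k]\<close>, and index \<open>0\<close> is the formal convergent \<open>1/0\<close>.
\<close>

fun convergent_denom :: "real \<Rightarrow> nat \<Rightarrow> int" where
  "convergent_denom \<alpha> 0 = 0"
| "convergent_denom \<alpha> (Suc 0) = 1"
| "convergent_denom \<alpha> (Suc (Suc k)) =
     partial_quotient \<alpha> (Suc k) * convergent_denom \<alpha> (Suc k) + convergent_denom \<alpha> k"

fun convergent_num :: "real \<Rightarrow> nat \<Rightarrow> int" where
  "convergent_num \<alpha> 0 = 1"
| "convergent_num \<alpha> (Suc 0) = partial_quotient \<alpha> 0"
| "convergent_num \<alpha> (Suc (Suc k)) =
     partial_quotient \<alpha> (Suc k) * convergent_num \<alpha> (Suc k) + convergent_num \<alpha> k"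

text \<open>The linear form q\<alpha> - p keeps its sign and satisfies the same recursion as p and
  q; at the formal index 0 it is -1.\<close>

definition convergent_error :: "real \<Rightarrow> nat \<Rightarrow> real" where
  "convergent_error \<alpha> k = of_int (convergent_denom \<alpha> k) * \<alpha> - of_int (convergent_num \<alpha> k)"

lemma dist_nearest_int_le: "dist_nearest_int x \<le> \<bar>x - of_int p\<bar>"
  unfolding dist_nearest_int_def using round_diff_minimal[of x p] by simp

lemma complete_quotient_irrational:
  assumes "\<alpha> \<notin> \<rat>"
  shows "complete_quotient \<alpha> k \<notin> \<rat>"
proof (induction k)
  case (Suc k)
  show ?case
  proof
    assume "complete_quotient \<alpha> (Suc k) \<in> \<rat>"
    then have "inverse (complete_quotient \<alpha> (Suc k)) \<in> \<rat>" by (rule Rats_inverse)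
    then have "frac (complete_quotient \<alpha> k) + of_int \<lfloor>complete_quotient \<alpha> k\<rfloor> \<in> \<rat>"
      by (intro Rats_add) auto
    with Suc show False by (simp add: frac_def)
  qed
qed (use assms in simp)

lemma frac_complete_quotient_pos:
  assumes "\<alpha> \<notin> \<rat>"
  shows "0 < frac (complete_quotient \<alpha> k)"
  using complete_quotient_irrational[OF assms, of k] Ints_subset_Rats
  by (metis frac_gt_0_iff subsetD)

lemma partial_quotient_ge_1:
  assumes "\<alpha> \<notin> \<rat>"
  shows "1 \<le> partial_quotient \<alpha> (Suc k)"
proof -
  have "1 \<le> 1 / frac (complete_quotient \<alpha> k)"
    using frac_complete_quotient_pos[OF assms, of k] frac_lt_1[of "complete_quotient \<alpha> k"]
    by (simp only: le_divide_eq_1_pos less_imp_le)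
  then show ?thesis by (simp add: partial_quotient_def le_floor_iff)
qed

text \<open>Errors obey the two-term recursion of the convergents. Eliminating the older error by
  the induction hypothesis leaves the coefficient floor(x) - x = -frac x, where x is the next
  complete quotient. Hence errors alternate in sign and shrink.\<close>

lemma convergent_error_Suc:
  assumes "\<alpha> \<notin> \<rat>"
  shows "convergent_error \<alpha> (Suc k) = - frac (complete_quotient \<alpha> k) * convergent_error \<alpha> k"
proof (induction k)
  case 0
  then show ?case by (simp add: convergent_error_def partial_quotient_def frac_def)
next
  case (Suc k)
  let ?b = "frac (complete_quotient \<alpha> k)"
  have b: "?b > 0" by (rule frac_complete_quotient_pos[OF assms])
  have "convergent_error \<alpha> (Suc (Suc k))
      = partial_quotient \<alpha> (Suc k) * convergent_error \<alpha> (Suc k) + convergent_error \<alpha> k"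
    by (simp add: convergent_error_def algebra_simps)
  also have "convergent_error \<alpha> k = - (1 / ?b) * convergent_error \<alpha> (Suc k)"
    using Suc b by simp
  also have "partial_quotient \<alpha> (Suc k) * convergent_error \<alpha> (Suc k) + \<dots>
      = - frac (complete_quotient \<alpha> (Suc k)) * convergent_error \<alpha> (Suc k)"
    by (simp add: partial_quotient_def frac_def[of "1 / ?b"] algebra_simps)
  finally show ?case .
qed

lemma abs_convergent_error_decreasing:
  assumes "\<alpha> \<notin> \<rat>"
  shows "\<bar>convergent_error \<alpha> (Suc k)\<bar> \<le> \<bar>convergent_error \<alpha> k\<bar>"
  using frac_lt_1[of "complete_quotient \<alpha> k"] frac_complete_quotient_pos[OF assms, of k]
  by (simp add: convergent_error_Suc[OF assms] abs_mult mult_left_le_one_le)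

lemma convergent_det:
  "convergent_denom \<alpha> (Suc k) * convergent_num \<alpha> k - convergent_denom \<alpha> k * convergent_num \<alpha> (Suc k)
    = (- 1) ^ k"
  by (induction k) (simp_all add: algebra_simps)

lemma convergent_denom_Suc_pos:
  assumes "\<alpha> \<notin> \<rat>"
  shows "0 < convergent_denom \<alpha> (Suc k) \<and> 0 \<le> convergent_denom \<alpha> k
    \<and> convergent_denom \<alpha> k \<le> convergent_denom \<alpha> (Suc k)"
proof (induction k)
  case (Suc k)
  have "1 * convergent_denom \<alpha> (Suc k) \<le> partial_quotient \<alpha> (Suc k) * convergent_denom \<alpha> (Suc k)"
    using Suc partial_quotient_ge_1[OF assms] by (intro mult_right_mono) auto
  then have "convergent_denom \<alpha> (Suc k) \<le> partial_quotient \<alpha> (Suc k) * convergent_denom \<alpha> (Suc k)"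
    by (simp only: mult_1)
  with Suc show ?case unfolding convergent_denom.simps(3) by linarith
qed simp

lemma convergent_denom_growth:
  assumes "\<alpha> \<notin> \<rat>"
  shows "2 * convergent_denom \<alpha> k \<le> convergent_denom \<alpha> (Suc (Suc k))"
proof -
  have "1 * convergent_denom \<alpha> (Suc k) \<le> partial_quotient \<alpha> (Suc k) * convergent_denom \<alpha> (Suc k)"
    using convergent_denom_Suc_pos[OF assms, of k] partial_quotient_ge_1[OF assms]
    by (intro mult_right_mono) auto
  then have "convergent_denom \<alpha> (Suc k) \<le> partial_quotient \<alpha> (Suc k) * convergent_denom \<alpha> (Suc k)"
    by (simp only: mult_1)
  with convergent_denom_Suc_pos[OF assms, of k] show ?thesis
    unfolding convergent_denom.simps(3) by linarith
qed

text \<open>The denominators are only known to double every two indices, so their squares grow like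
  \<open>2 ^ k\<close>; the factor 2 pays for the odd starting case of the two-step
  induction.\<close>

lemma convergent_denom_exponential:
  assumes "\<alpha> \<notin> \<rat>"
  shows "2 ^ k \<le> (convergent_denom \<alpha> (Suc k))\<^sup>2 * 2"
proof (induction k rule: induct_nat_012)
  case 1
  show ?case using convergent_denom_Suc_pos[OF assms, of "Suc 0"]
    by (simp add: one_le_power)
next
  case (ge2 k)
  have "2 ^ Suc (Suc k) \<le> (2 * convergent_denom \<alpha> (Suc k))\<^sup>2 * 2"
    using ge2(1) by (simp add: power_mult_distrib)
  also have "\<dots> \<le> (convergent_denom \<alpha> (Suc (Suc (Suc k))))\<^sup>2 * 2"
    using convergent_denom_growth[OF assms, of "Suc k"] convergent_denom_Suc_pos[OF assms, of k]
    by (intro mult_right_mono power_mono) auto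
  finally show ?case .
qed simp

text \<open>The determinant identity, rewritten with errors in place of numerators, expresses 1 as
  the modulus of a combination of two terms, each of modulus at most the larger denominator times
  the larger error.\<close>

lemma convergent_error_ge:
  assumes "\<alpha> \<notin> \<rat>"
  shows "1 \<le> 2 * real_of_int (convergent_denom \<alpha> (Suc k)) * \<bar>convergent_error \<alpha> k\<bar>"
proof -
  let ?q = "convergent_denom \<alpha>" and ?e = "convergent_error \<alpha>"
  have q: "0 \<le> ?q k" "?q k \<le> ?q (Suc k)" "0 < ?q (Suc k)"
    using convergent_denom_Suc_pos[OF assms, of k] by auto
  have "of_int (?q k) * ?e (Suc k) - of_int (?q (Suc k)) * ?e k
      = real_of_int (?q (Suc k) * convergent_num \<alpha> k - ?q k * convergent_num \<alpha> (Suc k))"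
    by (simp add: convergent_error_def algebra_simps)
  also have "\<dots> = (- 1) ^ k" by (simp add: convergent_det)
  finally have "1 = \<bar>of_int (?q k) * ?e (Suc k) - of_int (?q (Suc k)) * ?e k\<bar>"
    by simp
  also have "\<dots> \<le> of_int (?q k) * \<bar>?e (Suc k)\<bar> + of_int (?q (Suc k)) * \<bar>?e k\<bar>"
    using q abs_triangle_ineq4[of "of_int (?q k) * ?e (Suc k)" "of_int (?q (Suc k)) * ?e k"]
    by (simp add: abs_mult)
  also have "\<dots> \<le> of_int (?q (Suc k)) * \<bar>?e k\<bar> + of_int (?q (Suc k)) * \<bar>?e k\<bar>"
    using q abs_convergent_error_decreasing[OF assms, of k]
    by (intro add_mono mult_mono) auto
  finally show ?thesis by linarith
qed

text \<open>
  Two consecutive convergents form a unimodular basis, so \<open>(m, p)\<close> has integer coordinates \<open>u, v\<close>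
  in it.  They have opposite signs when \<open>m\<close> is small, and so have the two errors; hence nothing cancels.
\<close>

lemma best_approximation:
  assumes irr: "\<alpha> \<notin> \<rat>" and m: "1 \<le> m" "m < convergent_denom \<alpha> (Suc k)"
  shows "\<bar>convergent_error \<alpha> k\<bar> \<le> \<bar>of_int m * \<alpha> - of_int p\<bar>"
proof -
  let ?q = "convergent_denom \<alpha>" and ?p = "convergent_num \<alpha>" and ?e = "convergent_error \<alpha>"
  define s :: int where "s = (- 1) ^ k"
  have ss: "s * s = 1" by (simp add: s_def flip: power_add mult_2)
  have det: "?q (Suc k) * ?p k - ?q k * ?p (Suc k) = s"
    unfolding s_def by (rule convergent_det)
  \<comment> \<open>Cramer's rule: since \<open>s * s = 1\<close>, multiplying by \<open>s\<close>
    divides by the determinant.\<close>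
  define u where "u = s * (?q (Suc k) * p - m * ?p (Suc k))"
  define v where "v = s * (m * ?p k - ?q k * p)"
  have "u * ?q k + v * ?q (Suc k) = s * m * (?q (Suc k) * ?p k - ?q k * ?p (Suc k))"
    by (simp add: u_def v_def algebra_simps)
  then have mu: "m = u * ?q k + v * ?q (Suc k)" using det ss by (simp add: algebra_simps)
  have "u * ?p k + v * ?p (Suc k) = s * p * (?q (Suc k) * ?p k - ?q k * ?p (Suc k))"
    by (simp add: u_def v_def algebra_simps)
  then have pu: "p = u * ?p k + v * ?p (Suc k)" using det ss by (simp add: algebra_simps)
  have eq: "of_int m * \<alpha> - of_int p = of_int u * ?e k + of_int v * ?e (Suc k)"
    by (subst mu, subst pu) (simp add: convergent_error_def algebra_simps)
  have q: "0 \<le> ?q k" "0 < ?q (Suc k)" using convergent_denom_Suc_pos[OF irr, of k] by auto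
  have u0: "u \<noteq> 0"
  proof
    assume "u = 0"
    with mu have *: "m = v * ?q (Suc k)" by simp
    with m q have "v > 0" using zero_less_mult_pos2[of v "?q (Suc k)"] by linarith
    then have "1 * ?q (Suc k) \<le> v * ?q (Suc k)" using q by (intro mult_right_mono) auto
    with * m show False by simp
  qed
  have uv: "u * v \<le> 0"
  proof (rule ccontr)
    assume "\<not> u * v \<le> 0"
    then consider "u > 0" "v > 0" | "u < 0" "v < 0" by (auto simp: mult_le_0_iff not_le zero_less_mult_iff)
    then show False
    proof cases
      case 1
      then have "1 * ?q (Suc k) \<le> v * ?q (Suc k)" "0 \<le> u * ?q k"
        using q by (auto intro!: mult_right_mono)
      with mu m show False by simp
    next
      case 2
      then have "v * ?q (Suc k) \<le> 0" "u * ?q k \<le> 0"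
        using q by (auto simp: mult_le_0_iff)
      with mu m show False by simp
    qed
  qed
  have ee: "?e (Suc k) * ?e k \<le> 0"
    using frac_complete_quotient_pos[OF irr, of k]
    by (simp add: convergent_error_Suc[OF irr] mult.assoc)
  have "0 \<le> of_int (u * v) * (?e (Suc k) * ?e k)"
    using uv ee by (intro mult_nonpos_nonpos) (simp_all only: of_int_le_0_iff)
  then have same: "0 \<le> (of_int u * ?e k) * (of_int v * ?e (Suc k))" by (simp add: algebra_simps)
  have abs_add: "\<bar>a\<bar> \<le> \<bar>a + b\<bar>" if "0 \<le> a * b" for a b :: real
    using that unfolding zero_le_mult_iff by linarith
  have "\<bar>?e k\<bar> \<le> \<bar>of_int u * ?e k\<bar>"
  proof -
    have "1 \<le> \<bar>real_of_int u\<bar>" using u0 by linarith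
    then show ?thesis by (simp add: abs_mult mult_le_cancel_right1)
  qed
  also have "\<dots> \<le> \<bar>of_int u * ?e k + of_int v * ?e (Suc k)\<bar>"
    using same by (rule abs_add)
  finally show ?thesis by (simp add: eq)
qed

text \<open>Choose k with q(k+1) \<le> m < q(k+2). Best approximation bounds the distance below by
  the error at k+1, which is at least 1 / (2 q(k+2)), and q(k+2) is at most (a(k+1) + 1) m. The
  bound on \<open>2 ^ k\<close> makes k logarithmic in m, which turns polynomial growth of the
  partial quotients into a power of a logarithm.\<close>

lemma dist_nearest_int_ge_partial_quotient:
  assumes irr: "\<alpha> \<notin> \<rat>" and m: "1 \<le> m"
  obtains k where "2 ^ k \<le> 2 * (real m)\<^sup>2"
    and "1 / (2 * (of_int (partial_quotient \<alpha> (Suc k)) + 1) * real m) \<le> dist_nearest_int (real m * \<alpha>)"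
proof -
  let ?q = "convergent_denom \<alpha>"
  have ex: "\<exists>j. int m < ?q (Suc j)"
  proof -
    have "\<not> (\<forall>j. ?q (Suc j) \<le> int m)"
    proof
      assume *: "\<forall>j. ?q (Suc j) \<le> int m"
      \<comment> \<open>With this index the exponential lower bound would give 2^j \<le> 2 m^2 = j,
        which is absurd.\<close>
      let ?j = "2 * m ^ 2"
      have "(2::int) ^ ?j \<le> (?q (Suc ?j))\<^sup>2 * 2" by (rule convergent_denom_exponential[OF irr])
      also have "\<dots> \<le> (int m)\<^sup>2 * 2"
        using * convergent_denom_Suc_pos[OF irr, of ?j]
        by (intro mult_right_mono power_mono) auto
      also have "\<dots> = int ?j" by simp
      also have "\<dots> < int (2 ^ ?j)" by (simp only: of_nat_less_iff less_exp)
      finally show False by simp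
    qed
    then show ?thesis by (auto simp: not_le)
  qed
  define j where "j = (LEAST j. int m < ?q (Suc j))"
  have j: "int m < ?q (Suc j)" unfolding j_def using ex by (rule LeastI_ex)
  have "j \<noteq> 0" using j m by (intro notI) simp
  then obtain k where jk: "j = Suc k" using not0_implies_Suc by blast
  have k: "?q (Suc k) \<le> int m"
    using not_less_Least[of k "\<lambda>j. int m < ?q (Suc j)"] jk j_def by (simp add: not_less)
  have pos: "0 < ?q (Suc k)" "0 \<le> ?q k" "?q k \<le> ?q (Suc k)"
    using convergent_denom_Suc_pos[OF irr, of k] by auto
  have a: "1 \<le> partial_quotient \<alpha> (Suc k)" by (rule partial_quotient_ge_1[OF irr])
  have "(2::int) ^ k \<le> (?q (Suc k))\<^sup>2 * 2" by (rule convergent_denom_exponential[OF irr])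
  also have "\<dots> \<le> (int m)\<^sup>2 * 2" using k pos by (intro mult_right_mono power_mono) auto
  finally have "real_of_int (2 ^ k) \<le> real_of_int ((int m)\<^sup>2 * 2)" by (simp only: of_int_le_iff)
  then have 1: "2 ^ k \<le> 2 * (real m)\<^sup>2" by simp
  let ?e = "\<bar>convergent_error \<alpha> (Suc k)\<bar>"
  have "?q (Suc (Suc k)) \<le> (partial_quotient \<alpha> (Suc k) + 1) * ?q (Suc k)"
    using pos by (simp add: algebra_simps)
  also have "\<dots> \<le> (partial_quotient \<alpha> (Suc k) + 1) * int m"
    using k a by (intro mult_left_mono) auto
  finally have "real_of_int (?q (Suc (Suc k))) \<le> real_of_int ((partial_quotient \<alpha> (Suc k) + 1) * int m)"
    by (simp only: of_int_le_iff)
  then have qle: "real_of_int (?q (Suc (Suc k))) \<le> (of_int (partial_quotient \<alpha> (Suc k)) + 1) * real m"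
    by simp
  have "1 \<le> 2 * real_of_int (?q (Suc (Suc k))) * ?e" by (rule convergent_error_ge[OF irr])
  also have "\<dots> \<le> 2 * ((of_int (partial_quotient \<alpha> (Suc k)) + 1) * real m) * ?e"
    using qle by (intro mult_right_mono mult_left_mono) auto
  finally have "1 \<le> ?e * (2 * (of_int (partial_quotient \<alpha> (Suc k)) + 1) * real m)"
    by (simp add: algebra_simps)
  moreover have "0 < 2 * (real_of_int (partial_quotient \<alpha> (Suc k)) + 1) * real m"
    using a m by (intro mult_pos_pos) auto
  ultimately have "1 / (2 * (of_int (partial_quotient \<alpha> (Suc k)) + 1) * real m) \<le> ?e"
    by (simp only: pos_divide_le_eq)
  also have "\<dots> \<le> dist_nearest_int (real m * \<alpha>)"
    unfolding dist_nearest_int_def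
    using best_approximation[OF irr, of "int m" "Suc k" "round (real m * \<alpha>)"] m j jk by simp
  finally show ?thesis using that 1 by blast
qed

subsection \<open>The Fourier series of the second Bernoulli polynomial\<close>

text \<open>Termwise differentiation turns the dilogarithm into the logarithm series. The
  coefficient at n = 0 is 0 because division by zero yields 0, and the product \<open>z * F'\<close>
  avoids an exception at z = 0.\<close>

lemma dilog_has_field_derivative:
  fixes z :: complex
  assumes "norm z < 1"
  defines "F \<equiv> \<lambda>z::complex. \<Sum>n. (1 / (of_nat n)\<^sup>2) * z ^ n"
  obtains F' where "(F has_field_derivative F') (at z)" "z * F' = - Ln (1 - z)"
proof -
  let ?c = "\<lambda>n. 1 / (of_nat n :: complex)\<^sup>2"
  have summ: "summable (\<lambda>n. ?c n * w ^ n)" if "norm w < 1" for w :: complex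
  proof (rule summable_comparison_test')
    show "summable (\<lambda>n. norm w ^ n)" using that by (simp add: summable_geometric)
    show "norm (?c n * w ^ n) \<le> norm w ^ n" if "n \<ge> 0" for n
    proof (cases "n = 0")
      case False
      then have "1 / (real n)\<^sup>2 \<le> 1" by (simp add: one_le_power)
      then have "1 / (real n)\<^sup>2 * norm w ^ n \<le> 1 * norm w ^ n" by (intro mult_right_mono) auto
      then show ?thesis by (simp add: norm_mult norm_divide norm_power)
    qed simp
  qed
  have d: "(F has_field_derivative (\<Sum>n. diffs ?c n * z ^ n)) (at z)"
    unfolding F_def using assms(1) summ by (intro termdiffs_strong'[where K = 1]) auto
  have dc: "diffs ?c n = 1 / of_nat (Suc n)" for n
    by (simp add: diffs_def power2_eq_square field_simps del: of_nat_Suc)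
  have "(\<lambda>n. - ((- (- z)) ^ n) / of_nat n) sums Ln (1 + (- z))"
    using assms by (intro Ln_series') simp
  then have "(\<lambda>n. z ^ n / of_nat n) sums (- Ln (1 - z))" using sums_minus by fastforce
  then have "(\<lambda>n. z ^ Suc n / of_nat (Suc n)) sums (- Ln (1 - z))"
    by (subst sums_Suc_iff) simp
  moreover have "(\<lambda>n. diffs ?c n * z ^ n) sums (\<Sum>n. diffs ?c n * z ^ n)"
    using summ assms by (intro summable_sums termdiff_converges[where K = 1]) auto
  then have "(\<lambda>n. z * (diffs ?c n * z ^ n)) sums (z * (\<Sum>n. diffs ?c n * z ^ n))"
    by (rule sums_mult)
  then have "(\<lambda>n. z ^ Suc n / of_nat (Suc n)) sums (z * (\<Sum>n. diffs ?c n * z ^ n))"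
    by (simp add: dc del: of_nat_Suc)
  ultimately have "z * (\<Sum>n. diffs ?c n * z ^ n) = - Ln (1 - z)" using sums_unique2 by blast
  with d that show ?thesis by blast
qed

text \<open>In polar form the number is 2 sin(pi t) times \<open>cis (pi * t - pi / 2)\<close>, and
  this angle lies in the principal range. The positive real part keeps it off the branch
  cut.\<close>

lemma Im_Ln_one_minus_cis:
  assumes "0 < t" "t < 1"
  shows "Im (Ln (1 - cis (2 * pi * t))) = pi * (t - 1 / 2)"
    and "0 < Re (1 - cis (2 * pi * t))"
proof -
  have s: "sin (pi * t) > 0" using assms by (intro sin_gt_zero) auto
  have bnd: "0 < pi * t" "pi * t < pi" using assms by auto
  have *: "2 * pi * t = 2 * (pi * t)" by simp
  have re: "Re (1 - cis (2 * pi * t)) = 2 * (sin (pi * t))\<^sup>2"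
    unfolding * by (simp add: cos_double_sin)
  show "0 < Re (1 - cis (2 * pi * t))" unfolding re using s by simp
  have "exp (Complex (ln (2 * sin (pi * t))) (pi * t - pi / 2)) = of_real (2 * sin (pi * t)) * cis (pi * t - pi / 2)"
    using s by (simp add: exp_eq_polar)
  also have "\<dots> = 1 - cis (2 * pi * t)"
    unfolding * by (rule complex_eqI) (simp_all add: cos_diff sin_diff cos_double_sin sin_double power2_eq_square)
  finally have "Ln (1 - cis (2 * pi * t)) = Complex (ln (2 * sin (pi * t))) (pi * t - pi / 2)"
    by (rule Ln_unique) (unfold complex.sel, use pi_gt_zero bnd in linarith, use pi_gt_zero bnd in linarith)
  then show "Im (Ln (1 - cis (2 * pi * t))) = pi * (t - 1 / 2)" by (simp add: algebra_simps)
qed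

text \<open>
  With \<open>Li\<close> the dilogarithm, \<open>Re (Li (r exp (2\<pi>it)))\<close> has derivative
  \<open>2\<pi> Im (Ln (1 - r exp (2\<pi>it)))\<close> in \<open>t\<close>; this tends boundedly to \<open>2\<pi>\<^sup>2(t - 1/2)\<close> as \<open>r\<close> tends to \<open>1\<close>.
\<close>

theorem bernoulli2_fourier:
  fixes t :: real
  assumes "0 \<le> t" "t \<le> 1"
  shows "(\<lambda>m. cos (2 * pi * real (Suc m) * t) / (real (Suc m))\<^sup>2) sums (pi\<^sup>2 * (t\<^sup>2 - t + 1 / 6))"
proof -
  define F where "F = (\<lambda>z::complex. \<Sum>n. (1 / (of_nat n)\<^sup>2) * z ^ n)"
  define r where "r = (\<lambda>k. 1 - inverse (real (Suc k)))"
  have r: "0 \<le> r k" "r k < 1" for k by (auto simp: r_def field_simps)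
  have rlim: "r \<longlonglongrightarrow> 1"
    unfolding r_def using tendsto_diff[OF tendsto_const LIMSEQ_inverse_real_of_nat] by simp
  define z where "z = (\<lambda>k s. of_real (r k) * cis (2 * pi * s))"
  have zn: "norm (z k s) < 1" for k s using r by (simp add: z_def norm_mult)
  define f where "f = (\<lambda>k s. 2 * pi * Im (Ln (1 - z k s)))"
  define G where "G = (\<lambda>s. \<Sum>n. cos (2 * pi * real n * s) / (real n)\<^sup>2)"
  have summ2: "summable (\<lambda>n. 1 / (real n)\<^sup>2)"
    using inverse_power_summable[of 2, where 'a = real] by (simp add: inverse_eq_divide)
  have summG: "summable (\<lambda>n. cos (2 * pi * real n * s) / (real n)\<^sup>2)" for s
    by (rule summable_comparison_test'[OF summ2]) (simp add: divide_right_mono)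
  have deriv: "((\<lambda>s. Re (F (z k s))) has_vector_derivative f k s) (at s within S)" for k s S
  proof -
    obtain F' where F': "(F has_field_derivative F') (at (z k s))" "z k s * F' = - Ln (1 - z k s)"
      using dilog_has_field_derivative[OF zn] unfolding F_def by blast
    have "(z k has_vector_derivative (2 * pi * \<i> * z k s)) (at s)"
      unfolding z_def has_vector_derivative_def
      by (auto intro!: derivative_eq_intros simp: scaleR_conv_of_real algebra_simps)
    from field_vector_diff_chain_at[OF this F'(1)]
    have "((\<lambda>s. F (z k s)) has_vector_derivative (2 * pi * \<i> * (z k s * F'))) (at s)"
      by (simp add: o_def mult.assoc)
    then have "((\<lambda>s. Re (F (z k s))) has_vector_derivative Re (2 * pi * \<i> * (z k s * F'))) (at s)"
      by (rule bounded_linear.has_vector_derivative[OF bounded_linear_Re])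
    then show ?thesis unfolding F'(2) f_def by (auto intro: has_vector_derivative_at_within)
  qed
  have int: "(f k has_integral (Re (F (z k t)) - Re (F (z k 0)))) {0..t}" for k
    by (rule fundamental_theorem_of_calculus[OF assms(1)]) (rule deriv)
  \<comment> \<open>At s = 0 and s = 1 the point \<open>z k s\<close> is a real number below 1, so
    the logarithm is real and \<open>f k s\<close> is 0. The pointwise limit there is 0 instead of
    the value of the linear function.\<close>
  define g where "g = (\<lambda>s. if 0 < s \<and> s < 1 then 2 * pi\<^sup>2 * (s - 1 / 2) else 0)"
  have flim: "(\<lambda>k. f k s) \<longlonglongrightarrow> g s" if "s \<in> {0..t}" for s
  proof (cases "0 < s \<and> s < 1")
    case True
    have "(\<lambda>k. z k s) \<longlonglongrightarrow> of_real 1 * cis (2 * pi * s)"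
      unfolding z_def by (intro tendsto_intros rlim)
    then have "(\<lambda>k. 1 - z k s) \<longlonglongrightarrow> 1 - cis (2 * pi * s)"
      by (intro tendsto_intros) simp
    moreover have "1 - cis (2 * pi * s) \<notin> \<real>\<^sub>\<le>\<^sub>0"
      using Im_Ln_one_minus_cis(2)[of s] True by (auto simp: complex_nonpos_Reals_iff)
    ultimately have "(\<lambda>k. Ln (1 - z k s)) \<longlonglongrightarrow> Ln (1 - cis (2 * pi * s))"
      by (rule tendsto_Ln)
    then have "(\<lambda>k. f k s) \<longlonglongrightarrow> 2 * pi * Im (Ln (1 - cis (2 * pi * s)))"
      unfolding f_def by (intro tendsto_mult tendsto_const tendsto_Im)
    moreover have "2 * pi * Im (Ln (1 - cis (2 * pi * s))) = g s"
      using True by (simp add: Im_Ln_one_minus_cis g_def power2_eq_square)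
    ultimately show ?thesis by simp
  next
    case False
    then have "s = 0 \<or> s = 1" using that assms by auto
    then have "z k s = of_real (r k)" for k by (auto simp: z_def)
    then have "f k s = 0" for k
      using r[of k] Ln_of_real[of "1 - r k"] by (simp add: f_def)
    moreover have "g s = 0" unfolding g_def using False by (rule if_not_P)
    ultimately show ?thesis by simp
  qed
  have bound: "norm (f k s) \<le> 2 * pi * pi" for k s
  proof -
    have "1 - z k s \<noteq> 0" using zn[of k s] by auto
    then have "\<bar>Im (Ln (1 - z k s))\<bar> \<le> pi"
      using mpi_less_Im_Ln[of "1 - z k s"] Im_Ln_le_pi[of "1 - z k s"] by linarith
    then show ?thesis by (simp add: f_def abs_mult)
  qed
  have "(\<lambda>k. integral {0..t} (f k)) \<longlonglongrightarrow> integral {0..t} g"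
    by (rule dominated_convergence(2)[where h = "\<lambda>_. 2 * pi * pi"])
       (use int flim bound in \<open>auto simp: has_integral_integrable\<close>)
  moreover have "integral {0..t} g = pi\<^sup>2 * (t\<^sup>2 - t)"
  proof -
    have "((\<lambda>s. 2 * pi\<^sup>2 * (s - 1 / 2)) has_integral (pi\<^sup>2 * (t\<^sup>2 - t) - pi\<^sup>2 * (0\<^sup>2 - 0))) {0..t}"
      by (rule fundamental_theorem_of_calculus[OF assms(1)])
         (auto intro!: derivative_eq_intros simp: algebra_simps simp flip: has_real_derivative_iff_has_vector_derivative)
    then have "(g has_integral (pi\<^sup>2 * (t\<^sup>2 - t))) {0..t}"
      by (intro has_integral_spike_finite[of "{0, 1}" _ g, where f = "\<lambda>s. 2 * pi\<^sup>2 * (s - 1 / 2)"])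
         (use assms in \<open>auto simp: g_def\<close>)
    then show ?thesis by (rule integral_unique)
  qed
  moreover have "integral {0..t} (f k) = Re (F (z k t)) - Re (F (z k 0))" for k
    using int by (rule integral_unique)
  ultimately have lim1: "(\<lambda>k. Re (F (z k t)) - Re (F (z k 0))) \<longlonglongrightarrow> pi\<^sup>2 * (t\<^sup>2 - t)" by simp
  have ReF: "Re (F (z k s)) = (\<Sum>n. r k ^ n * cos (2 * pi * real n * s) / (real n)\<^sup>2)" for k s
  proof -
    have "summable (\<lambda>n. (1 / (of_nat n)\<^sup>2) * z k s ^ n)"
    proof (rule summable_comparison_test'[OF summ2])
      show "norm ((1 / (of_nat n)\<^sup>2) * z k s ^ n) \<le> 1 / (real n)\<^sup>2" if "n \<ge> 0" for n
        using power_le_one[of "norm (z k s)" n] zn[of k s]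
        by (simp add: norm_mult norm_divide norm_power divide_right_mono)
    qed
    then have "Re (F (z k s)) = (\<Sum>n. Re ((1 / (of_nat n)\<^sup>2) * z k s ^ n))"
      unfolding F_def by (rule Re_suminf)
    also have "(\<lambda>n. Re ((1 / (of_nat n)\<^sup>2) * z k s ^ n)) = (\<lambda>n. r k ^ n * cos (2 * pi * real n * s) / (real n)\<^sup>2)"
    proof
      fix n
      have "(1 / (of_nat n)\<^sup>2) * z k s ^ n = of_real (r k ^ n / (real n)\<^sup>2) * cis (real n * (2 * pi * s))"
        using Complex.DeMoivre[of "2 * pi * s" n] by (simp add: z_def power_mult_distrib)
      then show "Re ((1 / (of_nat n)\<^sup>2) * z k s ^ n) = r k ^ n * cos (2 * pi * real n * s) / (real n)\<^sup>2"
        by (simp only: times_complex.sel Re_complex_of_real Im_complex_of_real cis.sel) (simp add: mult_ac)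
    qed
    finally show ?thesis .
  qed
  \<comment> \<open>Abel summation: the majorant 1 / n^2 permits r to tend to 1 under the
    sum.\<close>
  have lim2: "(\<lambda>k. Re (F (z k s))) \<longlonglongrightarrow> G s" for s
    unfolding ReF G_def
  proof (rule tannerys_theorem[where M = "\<lambda>n. 1 / (real n)\<^sup>2", THEN conjunct2, THEN conjunct2])
    show "((\<lambda>k. r k ^ n * cos (2 * pi * real n * s) / (real n)\<^sup>2) \<longlongrightarrow> cos (2 * pi * real n * s) / (real n)\<^sup>2) sequentially" for n
    proof -
      have "(\<lambda>k. r k ^ n * (cos (2 * pi * real n * s) / (real n)\<^sup>2))
          \<longlonglongrightarrow> 1 ^ n * (cos (2 * pi * real n * s) / (real n)\<^sup>2)"
        by (intro tendsto_mult tendsto_power rlim tendsto_const)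
      then show ?thesis by simp
    qed
    show "\<forall>\<^sub>F (n, k) in at_top \<times>\<^sub>F sequentially. norm (r k ^ n * cos (2 * pi * real n * s) / (real n)\<^sup>2) \<le> 1 / (real n)\<^sup>2"
    proof (rule always_eventually, safe)
      fix n k
      have "\<bar>r k ^ n * cos (2 * pi * real n * s)\<bar> \<le> 1 * 1"
        unfolding abs_mult using r[of k] by (intro mult_mono) (auto intro!: power_le_one)
      then show "norm (r k ^ n * cos (2 * pi * real n * s) / (real n)\<^sup>2) \<le> 1 / (real n)\<^sup>2"
        by (simp add: divide_right_mono)
    qed
  qed (use summ2 in auto)
  have "(\<lambda>k. Re (F (z k t)) - Re (F (z k 0))) \<longlonglongrightarrow> G t - G 0"
    by (intro tendsto_diff lim2)
  with lim1 have "G t - G 0 = pi\<^sup>2 * (t\<^sup>2 - t)" using LIMSEQ_unique by blast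
  \<comment> \<open>Basel's sum fixes the constant of integration.\<close>
  moreover have "G 0 = pi\<^sup>2 / 6"
  proof -
    have "(\<lambda>n. cos (2 * pi * real (Suc n) * 0) / (real (Suc n))\<^sup>2) sums (pi\<^sup>2 / 6)"
      using inverse_squares_sums by (simp add: add.commute)
    then show ?thesis unfolding G_def by (subst (asm) sums_Suc_iff) (simp add: sums_iff)
  qed
  ultimately have "G t = pi\<^sup>2 * (t\<^sup>2 - t + 1 / 6)" by (simp add: algebra_simps)
  moreover have "(\<lambda>n. cos (2 * pi * real n * t) / (real n)\<^sup>2) sums G t"
    unfolding G_def by (rule summable_sums[OF summG])
  ultimately show ?thesis by (subst sums_Suc_iff) simp
qed

subsection \<open>The discrepancy as a Fourier series\<close>

text \<open>Allows the Lebesgue integrals in \<open>L2_discrepancy_sq\<close> to be computed as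
  gauge integrals; for a nonnegative Borel function a finite gauge integral already gives Lebesgue
  integrability.\<close>

lemma set_lebesgue_integral_eq_has_integral:
  fixes f :: "real \<Rightarrow> real"
  assumes "f \<in> borel_measurable borel" "\<And>x. 0 \<le> f x" "(f has_integral I) S" "S \<in> sets borel"
  shows "(LBINT x:S. f x) = I"
proof -
  have f: "(\<lambda>x. indicator S x *\<^sub>R f x) \<in> borel_measurable borel"
    using assms(1,4) by measurable
  have "((\<lambda>x. if x \<in> S then f x else 0) has_integral I) UNIV"
    using assms(3) by (simp add: has_integral_restrict_UNIV)
  moreover have "(\<lambda>x. if x \<in> S then f x else 0) = (\<lambda>x. indicator S x *\<^sub>R f x)"
    by (auto simp: indicator_def)
  ultimately have I: "((\<lambda>x. indicator S x *\<^sub>R f x) has_integral I) UNIV" by simp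
  have "0 \<le> I" using has_integral_nonneg[OF assms(3)] assms(2) by simp
  moreover have "integral\<^sup>N lborel (\<lambda>x. indicator S x *\<^sub>R f x) = I"
    using f I assms(2) by (intro nn_integral_has_integral_lborel) (auto simp: indicator_def)
  ultimately show ?thesis
    unfolding set_lebesgue_integral_def using f assms(2)
    by (subst integral_eq_nn_integral) (auto simp: indicator_def)
qed

section \<open>Inner products of symmetrised step functions\<close>

lemma has_integral_step:
  fixes g :: "real \<Rightarrow> real"
  assumes "0 \<le> a" "a \<le> 1" "(g has_integral i) {a..1}"
  shows "((\<lambda>x. of_bool (a < x) * g x) has_integral i) {0..1}"
proof -
  have "((\<lambda>x. if x \<in> {a..1} then g x else 0) has_integral i) {0..1}"
    using assms by (subst has_integral_restrict) auto
  then show ?thesis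
    by (rule has_integral_spike_finite[of "{a}", rotated 2]) (use assms in auto)
qed

lemma has_integral_step_1:
  assumes "0 \<le> a" "a \<le> 1"
  shows "((\<lambda>x::real. of_bool (a < x)) has_integral (1 - a)) {0..1}"
  using has_integral_step[OF assms, of "\<lambda>_. 1" "1 - a"] has_integral_const_real[of "1::real" a 1] assms by simp

lemma has_integral_step_x:
  assumes "0 \<le> a" "a \<le> 1"
  shows "((\<lambda>x::real. of_bool (a < x) * x) has_integral ((1 - a\<^sup>2) / 2)) {0..1}"
proof (rule has_integral_step[OF assms])
  have "((\<lambda>x. x) has_integral (1\<^sup>2 / 2 - a\<^sup>2 / 2)) {a..1}"
    by (rule fundamental_theorem_of_calculus[OF assms(2)])
       (auto intro!: derivative_eq_intros simp flip: has_real_derivative_iff_has_vector_derivative)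
  then show "((\<lambda>x. x) has_integral ((1 - a\<^sup>2) / 2)) {a..1}" by (simp add: diff_divide_distrib)
qed

lemma has_integral_square_unit: "((\<lambda>x::real. x\<^sup>2) has_integral (1 / 3)) {0..1}"
proof -
  have "((\<lambda>x::real. x\<^sup>2) has_integral (1 ^ 3 / 3 - 0 ^ 3 / 3)) {0..1}"
    by (rule fundamental_theorem_of_calculus)
       (auto intro!: derivative_eq_intros simp flip: has_real_derivative_iff_has_vector_derivative)
  then show ?thesis by simp
qed

text \<open>The contribution of one pair u, 1 - u to the discrepancy in x; subtracting 2x gives it
  mean zero over the unit interval.\<close>

definition sym_step :: "real \<Rightarrow> real \<Rightarrow> real" where
  "sym_step u x = of_bool (u < x) + of_bool (1 - u < x) - 2 * x"

text \<open>Closed form of the inner product of \<open>sym_step u\<close> and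
  \<open>sym_step v\<close>: the maxima come from products of two jumps, the squares from products
  of a jump with the linear part.\<close>

definition sym_step_inner :: "real \<Rightarrow> real \<Rightarrow> real" where
  "sym_step_inner u v = 4 / 3 - (max u v + max u (1 - v) + max (1 - u) v + max (1 - u) (1 - v))
     + (u\<^sup>2 + (1 - u)\<^sup>2) + (v\<^sup>2 + (1 - v)\<^sup>2)"

lemma has_integral_sym_step_mult:
  assumes u: "0 \<le> u" "u \<le> 1" and v: "0 \<le> v" "v \<le> 1"
  shows "((\<lambda>x. sym_step u x * sym_step v x) has_integral sym_step_inner u v) {0..1}"
proof -
  let ?s = "\<lambda>a x. of_bool (a < x) :: real"
  have "((\<lambda>x. (?s (max u v) x + ?s (max u (1 - v)) x + ?s (max (1 - u) v) x + ?s (max (1 - u) (1 - v)) x)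
          - 2 * (?s u x * x + ?s (1 - u) x * x + ?s v x * x + ?s (1 - v) x * x) + 4 * x\<^sup>2)
      has_integral ((1 - max u v) + (1 - max u (1 - v)) + (1 - max (1 - u) v) + (1 - max (1 - u) (1 - v))
          - 2 * ((1 - u\<^sup>2) / 2 + (1 - (1 - u)\<^sup>2) / 2 + (1 - v\<^sup>2) / 2 + (1 - (1 - v)\<^sup>2) / 2) + 4 * (1 / 3))) {0..1}"
    using u v by (intro has_integral_add has_integral_diff has_integral_mult_right has_integral_step_1
        has_integral_step_x has_integral_square_unit) auto
  moreover have "(\<lambda>x. (?s (max u v) x + ?s (max u (1 - v)) x + ?s (max (1 - u) v) x + ?s (max (1 - u) (1 - v)) x)
          - 2 * (?s u x * x + ?s (1 - u) x * x + ?s v x * x + ?s (1 - v) x * x) + 4 * x\<^sup>2)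
      = (\<lambda>x. sym_step u x * sym_step v x)"
    by (intro ext) (auto simp: sym_step_def power2_eq_square algebra_simps simp flip: of_bool_conj)
  moreover have "(1 - max u v) + (1 - max u (1 - v)) + (1 - max (1 - u) v) + (1 - max (1 - u) (1 - v))
          - 2 * ((1 - u\<^sup>2) / 2 + (1 - (1 - u)\<^sup>2) / 2 + (1 - v\<^sup>2) / 2 + (1 - (1 - v)\<^sup>2) / 2) + 4 * (1 / 3)
      = sym_step_inner u v"
    by (simp add: sym_step_inner_def field_simps)
  ultimately show ?thesis by simp
qed

text \<open>The value is minus the second Bernoulli polynomial; it supplies the cross term between
  the step functions and the linear remainder.\<close>

lemma has_integral_x_sym_step:
  assumes u: "0 \<le> u" "u \<le> 1"
  shows "((\<lambda>x. x * sym_step u x) has_integral - (u\<^sup>2 - u + 1 / 6)) {0..1}"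
proof -
  have "((\<lambda>x. of_bool (u < x) * x + of_bool (1 - u < x) * x - 2 * x\<^sup>2)
      has_integral ((1 - u\<^sup>2) / 2 + (1 - (1 - u)\<^sup>2) / 2 - 2 * (1 / 3))) {0..1}"
    using u by (intro has_integral_add has_integral_diff has_integral_mult_right
        has_integral_step_x has_integral_square_unit) auto
  moreover have "(\<lambda>x. of_bool (u < x) * x + of_bool (1 - u < x) * x - 2 * x\<^sup>2) = (\<lambda>x. x * sym_step u x)"
    by (intro ext) (simp add: sym_step_def power2_eq_square algebra_simps)
  moreover have "(1 - u\<^sup>2) / 2 + (1 - (1 - u)\<^sup>2) / 2 - 2 * (1 / 3) = - (u\<^sup>2 - u + 1 / 6)"
    by (simp add: field_simps power2_eq_square)
  ultimately show ?thesis by simp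
qed

text \<open>The inner product is the sum of the second Bernoulli polynomial at u - v and at u + v
  modulo 1, and the product formula for cosines merges the two series. The substitutes
  \<open>p\<close> and \<open>q\<close> lie in the unit interval, where the Bernoulli series is
  available, and evenness and periodicity show that they leave the cosines unchanged.\<close>

lemma sym_step_inner_fourier:
  assumes u: "0 \<le> u" "u \<le> 1" and v: "0 \<le> v" "v \<le> 1"
  shows "(\<lambda>m. 2 / pi\<^sup>2 * (cos (2 * pi * real (Suc m) * u) * cos (2 * pi * real (Suc m) * v) / (real (Suc m))\<^sup>2))
    sums sym_step_inner u v"
proof -
  define p where "p = \<bar>u - v\<bar>"
  define q where "q = (if u + v \<le> 1 then u + v else u + v - 1)"
  have p: "0 \<le> p" "p \<le> 1" and q: "0 \<le> q" "q \<le> 1" using u v by (auto simp: p_def q_def)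
  have cp: "cos (2 * pi * real (Suc m) * p) = cos (2 * pi * real (Suc m) * (u - v))" for m
  proof (cases "u \<ge> v")
    case False
    then have "2 * pi * real (Suc m) * p = - (2 * pi * real (Suc m) * (u - v))"
      by (simp add: p_def algebra_simps)
    then show ?thesis by (metis cos_minus)
  qed (simp add: p_def)
  have cq: "cos (2 * pi * real (Suc m) * q) = cos (2 * pi * real (Suc m) * (u + v))" for m
  proof (cases "u + v \<le> 1")
    case False
    then have "2 * pi * real (Suc m) * (u + v) = 2 * pi * real (Suc m) * q + 2 * pi * real (Suc m)"
      by (simp add: q_def algebra_simps)
    moreover have "cos (2 * pi * real (Suc m)) = 1" "sin (2 * pi * real (Suc m)) = 0"
      using cos_int_2pin[of "int (Suc m)"] sin_int_2pin[of "int (Suc m)"]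
      by (simp_all only: of_int_of_nat_eq)
    then have "cos (2 * pi * real (Suc m) * q + 2 * pi * real (Suc m)) = cos (2 * pi * real (Suc m) * q)"
      by (simp only: cos_add mult_1_right mult_zero_right diff_zero)
    ultimately show ?thesis by simp
  qed (simp add: q_def)
  have "(\<lambda>m. 1 / pi\<^sup>2 * (cos (2 * pi * real (Suc m) * p) / (real (Suc m))\<^sup>2 + cos (2 * pi * real (Suc m) * q) / (real (Suc m))\<^sup>2))
      sums (1 / pi\<^sup>2 * (pi\<^sup>2 * (p\<^sup>2 - p + 1 / 6) + pi\<^sup>2 * (q\<^sup>2 - q + 1 / 6)))"
    by (intro sums_mult sums_add bernoulli2_fourier p q)
  moreover have "1 / pi\<^sup>2 * (pi\<^sup>2 * (p\<^sup>2 - p + 1 / 6) + pi\<^sup>2 * (q\<^sup>2 - q + 1 / 6)) = sym_step_inner u v"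
  proof -
    have "1 / pi\<^sup>2 * (pi\<^sup>2 * (p\<^sup>2 - p + 1 / 6) + pi\<^sup>2 * (q\<^sup>2 - q + 1 / 6)) = p\<^sup>2 - p + q\<^sup>2 - q + 1 / 3"
      by (simp add: distrib_left[symmetric])
    also have "\<dots> = sym_step_inner u v"
      unfolding p_def q_def sym_step_inner_def max_def abs_if
      by (cases "u \<le> v"; cases "u + v \<le> 1") (auto simp: power2_eq_square algebra_simps)
    finally show ?thesis .
  qed
  moreover have "1 / pi\<^sup>2 * (cos (2 * pi * real (Suc m) * p) / (real (Suc m))\<^sup>2 + cos (2 * pi * real (Suc m) * q) / (real (Suc m))\<^sup>2)
    = 2 / pi\<^sup>2 * (cos (2 * pi * real (Suc m) * u) * cos (2 * pi * real (Suc m) * v) / (real (Suc m))\<^sup>2)" for m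
    unfolding cp cq right_diff_distrib distrib_left cos_add cos_diff by (simp add: field_simps)
  ultimately show ?thesis by simp
qed

lemma has_integral_partition:
  fixes f :: "real \<Rightarrow> real"
  assumes n: "0 < n" and f: "\<And>N. N < n \<Longrightarrow> (f has_integral g N) {real N / real n..real (Suc N) / real n}"
  shows "(f has_integral (\<Sum>N<n. g N)) {0..1}"
proof -
  have "(f has_integral (\<Sum>N<M. g N)) {0..real M / real n}" if "M \<le> n" for M
    using that
  proof (induction M)
    case 0
    show ?case using has_integral_null_real[of 0 0 f] by simp
  next
    case (Suc M)
    then show ?case
      by (auto intro!: has_integral_combine[of 0 "real M / real n"] f divide_right_mono simp del: of_nat_Suc)
  qed
  from this[of n] n show ?thesis by simp
qed

section \<open>The symmetric point set and its exact discrepancy\<close>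

lemma int_mult_irrational_notin_Ints:
  assumes "\<alpha> \<notin> \<rat>" "0 < k"
  shows "real k * \<alpha> \<notin> \<int>"
proof
  assume "real k * \<alpha> \<in> \<int>"
  then have "real k * \<alpha> / real k \<in> \<rat>" using Ints_subset_Rats by (intro Rats_divide) auto
  with assms show False by simp
qed

context
  fixes \<alpha> :: real and n :: nat
  assumes irrational: "\<alpha> \<notin> \<rat>" and n_pos: "0 < n"
begin

lemma frac_minus_eq: "0 < k \<Longrightarrow> frac (- (real k * \<alpha>)) = 1 - frac (real k * \<alpha>)"
  using int_mult_irrational_notin_Ints[OF irrational] by (simp add: frac_neg)

text \<open>Otherwise 2k\<alpha> would be an integer. This keeps the two halves of the point set
  disjoint.\<close>

lemma frac_ne_complement: "0 < k \<Longrightarrow> frac (real k * \<alpha>) \<noteq> 1 - frac (real k * \<alpha>)"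
proof
  assume k: "0 < k" and "frac (real k * \<alpha>) = 1 - frac (real k * \<alpha>)"
  then have "real (2 * k) * \<alpha> = of_int (1 + 2 * \<lfloor>real k * \<alpha>\<rfloor>)" by (simp add: frac_def algebra_simps)
  then have "real (2 * k) * \<alpha> \<in> \<int>" by (metis Ints_of_int)
  with int_mult_irrational_notin_Ints[OF irrational, of "2 * k"] k show False by simp
qed

lemma sym_points_eq:
  "sym_points n \<alpha> = (\<lambda>k. (frac (real k * \<alpha>), real k / real n)) ` {1..n}
    \<union> (\<lambda>k. (1 - frac (real k * \<alpha>), real k / real n)) ` {1..n}"
proof -
  have "{(frac (- (real k * \<alpha>)), real k / real n) | k. 1 \<le> k \<and> k \<le> n}
      = (\<lambda>k. (1 - frac (real k * \<alpha>), real k / real n)) ` {1..n}"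
    using frac_minus_eq by force
  then show ?thesis unfolding sym_points_def by auto
qed

text \<open>The second coordinate determines k, so each half is indexed injectively and a common
  point of the halves would have the same k in both. The free predicate serves both the cardinality
  and the box counts.\<close>

lemma card_sym_points_filter:
  "card {p \<in> sym_points n \<alpha>. P p} =
    (\<Sum>k=1..n. of_bool (P (frac (real k * \<alpha>), real k / real n)) + of_bool (P (1 - frac (real k * \<alpha>), real k / real n)))"
proof -
  let ?f = "\<lambda>k. (frac (real k * \<alpha>), real k / real n)"
  let ?g = "\<lambda>k. (1 - frac (real k * \<alpha>), real k / real n)"
  have "{p \<in> sym_points n \<alpha>. P p} = ?f ` {k\<in>{1..n}. P (?f k)} \<union> ?g ` {k\<in>{1..n}. P (?g k)}"
    unfolding sym_points_eq by auto
  then have "card {p \<in> sym_points n \<alpha>. P p} = card (?f ` {k\<in>{1..n}. P (?f k)} \<union> ?g ` {k\<in>{1..n}. P (?g k)})"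
    by (rule arg_cong)
  also have "\<dots> = card (?f ` {k\<in>{1..n}. P (?f k)}) + card (?g ` {k\<in>{1..n}. P (?g k)})"
  proof (rule card_Un_disjoint)
    have "?f k \<noteq> ?g l" if "k \<in> {1..n}" for k l
    proof
      assume eq: "?f k = ?g l"
      then have "k = l" using n_pos by simp
      with eq frac_ne_complement[of k] that show False by simp
    qed
    then show "?f ` {k\<in>{1..n}. P (?f k)} \<inter> ?g ` {k\<in>{1..n}. P (?g k)} = {}" by blast
  qed simp_all
  also have "\<dots> = card {k\<in>{1..n}. P (?f k)} + card {k\<in>{1..n}. P (?g k)}"
  proof -
    have "k = l" if "real k / real n = real l / real n" for k l using that n_pos by simp
    then have f: "inj_on ?f X" and g: "inj_on ?g X" for X by (blast intro: inj_onI)+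
    show ?thesis unfolding card_image[OF f] card_image[OF g] ..
  qed
  also have "\<dots> = (\<Sum>k=1..n. of_bool (P (?f k)) + of_bool (P (?g k)))"
  proof -
    have "{k\<in>{1..n}. Q k} = {1..n} \<inter> {k. Q k}" for Q by auto
    then show ?thesis by (simp add: sum.distrib)
  qed
  finally show ?thesis .
qed

lemma card_sym_points: "card (sym_points n \<alpha>) = 2 * n"
  using card_sym_points_filter[of "\<lambda>_. True"] by simp

lemma box_count_sym_points:
  "real (box_count (sym_points n \<alpha>) x y) = (\<Sum>k=1..n. of_bool (real k / real n < y) *
    (of_bool (frac (real k * \<alpha>) < x) + of_bool (1 - frac (real k * \<alpha>) < x)))"
proof -
  have fr: "0 \<le> 1 - frac (real k * \<alpha>)" for k using frac_lt_1[of "real k * \<alpha>"] by linarith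
  have "sym_points n \<alpha> \<inter> ({0..<x} \<times> {0..<y}) = {p \<in> sym_points n \<alpha>. p \<in> {0..<x} \<times> {0..<y}}" by auto
  then have "box_count (sym_points n \<alpha>) x y =
    (\<Sum>k=1..n. of_bool (real k / real n < y) * (of_bool (frac (real k * \<alpha>) < x) + of_bool (1 - frac (real k * \<alpha>) < x)))"
    unfolding box_count_def using fr
    by (simp only: card_sym_points_filter) (intro sum.cong refl, simp)
  then show ?thesis by simp
qed

definition frac_mult :: "nat \<Rightarrow> real" where "frac_mult k = frac (real k * \<alpha>)"

text \<open>The integral over x at height y, with c the indicator of the pairs below y: the square
  of the step part, the cross term, and the square of the linear remainder 2 (sum of c - n y)
  x.\<close>

definition inner_form :: "(nat \<Rightarrow> real) \<Rightarrow> real \<Rightarrow> real" where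
  "inner_form c y = (\<Sum>k=1..n. \<Sum>l=1..n. c k * c l * sym_step_inner (frac_mult k) (frac_mult l))
     + 4 * ((\<Sum>k=1..n. c k) - real n * y) * (\<Sum>k=1..n. c k * - ((frac_mult k)\<^sup>2 - frac_mult k + 1 / 6))
     + 4 / 3 * ((\<Sum>k=1..n. c k) - real n * y)\<^sup>2"

text \<open>Giving each counted pair its own mean 2x leaves of the area term only the difference
  between the number of counted pairs and n y.\<close>

lemma discrepancy_eq:
  fixes y :: real
  defines "c \<equiv> \<lambda>k. of_bool (real k / real n < y)"
  shows "real (box_count (sym_points n \<alpha>) x y) - real (card (sym_points n \<alpha>)) * x * y
    = (\<Sum>k=1..n. c k * sym_step (frac_mult k) x) + 2 * ((\<Sum>k=1..n. c k) - real n * y) * x"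
proof -
  have "(\<Sum>k=1..n. b k * h k) - real (2 * n) * x * y
      = (\<Sum>k=1..n. b k * (h k - 2 * x)) + 2 * ((\<Sum>k=1..n. b k) - real n * y) * x" for b h :: "nat \<Rightarrow> real"
  proof -
    have "(\<Sum>k=1..n. b k * (h k - 2 * x)) = (\<Sum>k=1..n. b k * h k) - (\<Sum>k=1..n. b k) * (2 * x)"
      unfolding right_diff_distrib sum_subtractf sum_distrib_right[symmetric] ..
    then show ?thesis by (simp add: algebra_simps)
  qed
  then show ?thesis
    unfolding box_count_sym_points card_sym_points c_def frac_mult_def sym_step_def .
qed

lemma inner_integral:
  fixes y :: real
  defines "c \<equiv> \<lambda>k. of_bool (real k / real n < y)"
  shows "(LBINT x:{0..1}. (real (box_count (sym_points n \<alpha>) x y) - real (card (sym_points n \<alpha>)) * x * y)\<^sup>2)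
    = inner_form c y"
proof (rule set_lebesgue_integral_eq_has_integral)
  have u01: "0 \<le> frac_mult k" "frac_mult k \<le> 1" for k
    using frac_lt_1[of "real k * \<alpha>"] by (auto simp: frac_mult_def)
  show "(\<lambda>x. (real (box_count (sym_points n \<alpha>) x y) - real (card (sym_points n \<alpha>)) * x * y)\<^sup>2) \<in> borel_measurable borel"
    unfolding box_count_sym_points by measurable
  define \<rho> where "\<rho> = (\<Sum>k=1..n. c k) - real n * y"
  have "((\<lambda>x. (\<Sum>k=1..n. \<Sum>l=1..n. c k * c l * (sym_step (frac_mult k) x * sym_step (frac_mult l) x))
      + 4 * \<rho> * (\<Sum>k=1..n. c k * (x * sym_step (frac_mult k) x)) + 4 * \<rho>\<^sup>2 * x\<^sup>2)
      has_integral ((\<Sum>k=1..n. \<Sum>l=1..n. c k * c l * sym_step_inner (frac_mult k) (frac_mult l))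
      + 4 * \<rho> * (\<Sum>k=1..n. c k * - ((frac_mult k)\<^sup>2 - frac_mult k + 1 / 6)) + 4 * \<rho>\<^sup>2 * (1 / 3))) {0..1}"
    by (intro has_integral_add has_integral_mult_right has_integral_sum has_integral_sym_step_mult
        has_integral_x_sym_step has_integral_square_unit u01) auto
  moreover have "(\<Sum>k=1..n. \<Sum>l=1..n. c k * c l * (sym_step (frac_mult k) x * sym_step (frac_mult l) x))
      + 4 * \<rho> * (\<Sum>k=1..n. c k * (x * sym_step (frac_mult k) x)) + 4 * \<rho>\<^sup>2 * x\<^sup>2
      = ((\<Sum>k=1..n. c k * sym_step (frac_mult k) x) + 2 * \<rho> * x)\<^sup>2" for x
  proof -
    let ?S = "\<Sum>k=1..n. c k * sym_step (frac_mult k) x"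
    have "?S * ?S = (\<Sum>k=1..n. \<Sum>l=1..n. c k * c l * (sym_step (frac_mult k) x * sym_step (frac_mult l) x))"
      by (simp add: sum_product mult_ac)
    moreover have "(\<Sum>k=1..n. c k * (x * sym_step (frac_mult k) x)) = x * ?S"
      by (simp add: sum_distrib_left mult_ac)
    ultimately show ?thesis by (simp add: power2_eq_square algebra_simps)
  qed
  moreover have "real (box_count (sym_points n \<alpha>) x y) - real (card (sym_points n \<alpha>)) * x * y
      = (\<Sum>k=1..n. c k * sym_step (frac_mult k) x) + 2 * \<rho> * x" for x
    unfolding c_def \<rho>_def by (rule discrepancy_eq)
  moreover have "4 * \<rho>\<^sup>2 * (1 / 3) = 4 / 3 * \<rho>\<^sup>2" by simp
  ultimately show "((\<lambda>x. (real (box_count (sym_points n \<alpha>) x y) - real (card (sym_points n \<alpha>)) * x * y)\<^sup>2)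
      has_integral inner_form c y) {0..1}"
    unfolding inner_form_def \<rho>_def[symmetric] by (simp only:)
qed auto

text \<open>Inside the strip between N/n and (N+1)/n exactly the first N pairs are counted, so the
  integrand is a quadratic in N - n y, which runs from 0 to -1. Integrating it over the strip gives
  the coefficients 2 and 4/9.\<close>

lemma discrepancy_eq_sum:
  "L2_discrepancy_sq (sym_points n \<alpha>) = (\<Sum>N<n. ((\<Sum>k=1..N. \<Sum>l=1..N. sym_step_inner (frac_mult k) (frac_mult l))
    + 2 * (\<Sum>k=1..N. (frac_mult k)\<^sup>2 - frac_mult k + 1 / 6) + 4 / 9) / real n)"
  unfolding L2_discrepancy_sq_def inner_integral
proof (rule set_lebesgue_integral_eq_has_integral)
  show "(\<lambda>y. inner_form (\<lambda>k. of_bool (real k / real n < y)) y) \<in> borel_measurable borel"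
    unfolding inner_form_def by measurable
  show "0 \<le> inner_form (\<lambda>k. of_bool (real k / real n < y)) y" for y
    unfolding inner_integral[symmetric] set_lebesgue_integral_def by (intro integral_nonneg_AE) auto
  show "((\<lambda>y. inner_form (\<lambda>k. of_bool (real k / real n < y)) y) has_integral
    (\<Sum>N<n. ((\<Sum>k=1..N. \<Sum>l=1..N. sym_step_inner (frac_mult k) (frac_mult l))
    + 2 * (\<Sum>k=1..N. (frac_mult k)\<^sup>2 - frac_mult k + 1 / 6) + 4 / 9) / real n)) {0..1}"
  proof (rule has_integral_partition[OF n_pos])
    fix N assume N: "N < n"
    define E where "E = (\<Sum>k=1..N. \<Sum>l=1..N. sym_step_inner (frac_mult k) (frac_mult l))"
    define J where "J = (\<Sum>k=1..N. (frac_mult k)\<^sup>2 - frac_mult k + 1 / 6)"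
    let ?a = "real N / real n" and ?b = "real (Suc N) / real n"
    let ?F = "\<lambda>y. E * y + 2 / real n * J * (real N - real n * y)\<^sup>2 - 4 / (9 * real n) * (real N - real n * y) ^ 3"
    have int: "((\<lambda>y. E - 4 * (real N - real n * y) * J + 4 / 3 * (real N - real n * y)\<^sup>2) has_integral (?F ?b - ?F ?a)) {?a..?b}"
    proof (rule fundamental_theorem_of_calculus)
      show "?a \<le> ?b" by (intro divide_right_mono) auto
      fix y
      have "(?F has_real_derivative E + 2 / real n * J * (2 * (real N - real n * y) * - real n)
          - 4 / (9 * real n) * (3 * (real N - real n * y)\<^sup>2 * - real n)) (at y within {?a..?b})"
        by (auto intro!: derivative_eq_intros)
      moreover have "E + 2 / real n * J * (2 * (real N - real n * y) * - real n)
          - 4 / (9 * real n) * (3 * (real N - real n * y)\<^sup>2 * - real n)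
          = E - 4 * (real N - real n * y) * J + 4 / 3 * (real N - real n * y)\<^sup>2"
        using n_pos by simp
      ultimately show "(?F has_vector_derivative E - 4 * (real N - real n * y) * J
          + 4 / 3 * (real N - real n * y)\<^sup>2) (at y within {?a..?b})"
        by (simp only: has_real_derivative_iff_has_vector_derivative)
    qed
    have val: "?F ?b - ?F ?a = (E + 2 * J + 4 / 9) / real n"
      using n_pos by (simp add: field_simps)
    \<comment> \<open>The endpoints are left out: at the lower one the strict inequality does not
      yet count the pair k = N when N > 0.\<close>
    have eq: "inner_form (\<lambda>k. of_bool (real k / real n < y)) y = E - 4 * (real N - real n * y) * J + 4 / 3 * (real N - real n * y)\<^sup>2"
      if "y \<in> {?a..?b} - {?a, ?b}" for y
    proof -
      have y: "real N < real n * y" "real n * y < real (Suc N)"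
        using that n_pos by (auto simp: field_simps)
      have c: "of_bool (real k / real n < y) = (of_bool (k \<le> N) :: real)" for k
      proof -
        have "real k / real n < y \<longleftrightarrow> real k < real n * y" using n_pos by (simp add: field_simps)
        also have "\<dots> \<longleftrightarrow> k \<le> N" using y by linarith
        finally show ?thesis by simp
      qed
      have sumN: "(\<Sum>k=1..n. of_bool (k \<le> N) * f k) = (\<Sum>k=1..N. f k)" for f :: "nat \<Rightarrow> real"
        using N by (intro sum.mono_neutral_cong_right) auto
      have "(\<Sum>k=1..n. \<Sum>l=1..n. of_bool (k \<le> N) * of_bool (l \<le> N) * sym_step_inner (frac_mult k) (frac_mult l)) = E"
        unfolding E_def by (simp only: mult.assoc sumN sum_distrib_left[symmetric])
      moreover have "(\<Sum>k=1..n. of_bool (k \<le> N)) = real N" using sumN[of "\<lambda>_. 1"] by simp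
      moreover have "(\<Sum>k=1..n. of_bool (k \<le> N) * - ((frac_mult k)\<^sup>2 - frac_mult k + 1 / 6)) = - J"
        unfolding sumN J_def by (simp only: sum_negf)
      ultimately show ?thesis unfolding inner_form_def c by simp
    qed
    show "((\<lambda>y. inner_form (\<lambda>k. of_bool (real k / real n < y)) y) has_integral
        ((\<Sum>k=1..N. \<Sum>l=1..N. sym_step_inner (frac_mult k) (frac_mult l)) + 2 * (\<Sum>k=1..N. (frac_mult k)\<^sup>2 - frac_mult k + 1 / 6) + 4 / 9) / real n) {?a..?b}"
      unfolding E_def[symmetric] J_def[symmetric]
      by (rule has_integral_spike_finite[of "{?a, ?b}", OF _ _ int[unfolded val]]) (simp, rule eq)
  qed
qed auto

lemma cos_frac_mult: "cos (2 * pi * real m * frac_mult k) = cos (2 * pi * real m * (real k * \<alpha>))"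
proof -
  have "2 * pi * real m * (real k * \<alpha>) = 2 * pi * real m * frac_mult k + 2 * pi * of_int (int m * \<lfloor>real k * \<alpha>\<rfloor>)"
    by (simp add: frac_mult_def frac_def algebra_simps)
  then show ?thesis by (simp only: cos_add cos_int_2pin sin_int_2pin mult_1_right mult_zero_right diff_zero)
qed

text \<open>Let C be the cosine sum up to N at frequency m. The double sum gives 4 C^2 and the
  Bernoulli sum 4 C over the common denominator 2 pi^2 m^2, so together they complete the square (1
  + 2C)^2 - 1 of a Dirichlet kernel. Only finite sums are interchanged with the series.\<close>

theorem L2_discrepancy_fourier:
  "(\<lambda>m. ((\<Sum>N<n. (1 + 2 * (\<Sum>k=1..N. cos (2 * pi * real (Suc m) * (real k * \<alpha>))))\<^sup>2) / real n - 1)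
      / (2 * pi\<^sup>2 * (real (Suc m))\<^sup>2))
    sums (L2_discrepancy_sq (sym_points n \<alpha>) - 4 / 9)"
proof -
  define c where "c m k = cos (2 * pi * real (Suc m) * (real k * \<alpha>))" for m k
  have u01: "0 \<le> frac_mult k" "frac_mult k \<le> 1" for k
    using frac_lt_1[of "real k * \<alpha>"] by (auto simp: frac_mult_def)
  have E: "(\<lambda>m. 2 / pi\<^sup>2 * (c m k * c m l / (real (Suc m))\<^sup>2)) sums sym_step_inner (frac_mult k) (frac_mult l)" for k l
    using sym_step_inner_fourier[OF u01 u01, of k l] by (simp only: cos_frac_mult c_def)
  have J: "(\<lambda>m. 1 / pi\<^sup>2 * (c m k / (real (Suc m))\<^sup>2)) sums ((frac_mult k)\<^sup>2 - frac_mult k + 1 / 6)" for k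
  proof -
    have "1 / pi\<^sup>2 * (pi\<^sup>2 * X) = X" for X by simp
    with sums_mult[OF bernoulli2_fourier[OF u01, of k], of "1 / pi\<^sup>2"] show ?thesis
      by (simp only: cos_frac_mult c_def)
  qed
  have "(\<lambda>m. \<Sum>N<n. ((\<Sum>k=1..N. \<Sum>l=1..N. 2 / pi\<^sup>2 * (c m k * c m l / (real (Suc m))\<^sup>2))
      + 2 * (\<Sum>k=1..N. 1 / pi\<^sup>2 * (c m k / (real (Suc m))\<^sup>2))) / real n)
    sums (\<Sum>N<n. ((\<Sum>k=1..N. \<Sum>l=1..N. sym_step_inner (frac_mult k) (frac_mult l))
      + 2 * (\<Sum>k=1..N. (frac_mult k)\<^sup>2 - frac_mult k + 1 / 6)) / real n)"
    by (intro sums_sum sums_divide sums_add sums_mult E J)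
  moreover have "(\<Sum>N<n. ((\<Sum>k=1..N. \<Sum>l=1..N. sym_step_inner (frac_mult k) (frac_mult l))
      + 2 * (\<Sum>k=1..N. (frac_mult k)\<^sup>2 - frac_mult k + 1 / 6)) / real n) = L2_discrepancy_sq (sym_points n \<alpha>) - 4 / 9"
    unfolding discrepancy_eq_sum using n_pos by (simp add: add_divide_distrib sum.distrib)
  moreover have "(\<Sum>N<n. ((\<Sum>k=1..N. \<Sum>l=1..N. 2 / pi\<^sup>2 * (c m k * c m l / (real (Suc m))\<^sup>2))
      + 2 * (\<Sum>k=1..N. 1 / pi\<^sup>2 * (c m k / (real (Suc m))\<^sup>2))) / real n)
    = ((\<Sum>N<n. (1 + 2 * (\<Sum>k=1..N. c m k))\<^sup>2) / real n - 1) / (2 * pi\<^sup>2 * (real (Suc m))\<^sup>2)" for m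
  proof -
    define M where "M = (real (Suc m))\<^sup>2"
    have M: "M > 0" by (simp add: M_def)
    have "((\<Sum>k=1..N. \<Sum>l=1..N. 2 / pi\<^sup>2 * (c m k * c m l / M)) + 2 * (\<Sum>k=1..N. 1 / pi\<^sup>2 * (c m k / M)))
      = ((1 + 2 * (\<Sum>k=1..N. c m k))\<^sup>2 - 1) / (2 * pi\<^sup>2 * M)" for N
    proof -
      let ?C = "\<Sum>k=1..N. c m k"
      have "(\<Sum>k=1..N. \<Sum>l=1..N. 2 / pi\<^sup>2 * (c m k * c m l / M)) = 2 / pi\<^sup>2 * (?C * ?C / M)"
        unfolding sum_product[of "c m" _ "c m"] by (simp only: sum_divide_distrib sum_distrib_left)
      moreover have "(\<Sum>k=1..N. 1 / pi\<^sup>2 * (c m k / M)) = 1 / pi\<^sup>2 * (?C / M)"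
        unfolding sum_divide_distrib sum_distrib_left ..
      ultimately show ?thesis using M by (simp add: field_simps power2_eq_square)
    qed
    then have "(\<Sum>N<n. ((\<Sum>k=1..N. \<Sum>l=1..N. 2 / pi\<^sup>2 * (c m k * c m l / M)) + 2 * (\<Sum>k=1..N. 1 / pi\<^sup>2 * (c m k / M))) / real n)
      = (\<Sum>N<n. ((1 + 2 * (\<Sum>k=1..N. c m k))\<^sup>2 - 1) / (2 * pi\<^sup>2 * M) / real n)" by simp
    also have "\<dots> = ((\<Sum>N<n. (1 + 2 * (\<Sum>k=1..N. c m k))\<^sup>2) - real n) / (2 * pi\<^sup>2 * M) / real n"
      unfolding sum_divide_distrib[symmetric] by (simp only: sum_subtractf) simp
    also have "\<dots> = ((\<Sum>N<n. (1 + 2 * (\<Sum>k=1..N. c m k))\<^sup>2) / real n - 1) / (2 * pi\<^sup>2 * M)"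
      using n_pos M by (simp add: field_simps)
    finally show ?thesis unfolding M_def .
  qed
  ultimately show ?thesis unfolding c_def by simp
qed

end

subsection \<open>Estimates for well-spaced multiples\<close>

lemma dist_nearest_int_nonneg: "0 \<le> dist_nearest_int x"
  by (simp add: dist_nearest_int_def)

lemma dist_nearest_int_le_half: "dist_nearest_int x \<le> 1 / 2"
  unfolding dist_nearest_int_def using of_int_round_abs_le[of x] by (simp add: abs_minus_commute)

lemma dist_nearest_int_pos:
  assumes "x \<notin> \<int>"
  shows "0 < dist_nearest_int x"
proof -
  have "x \<noteq> of_int (round x)" using assms Ints_of_int by metis
  then show ?thesis by (simp add: dist_nearest_int_def)
qed

lemma abs_sin_pi_eq: "\<bar>sin (pi * x)\<bar> = sin (pi * dist_nearest_int x)"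
proof -
  define t where "t = x - of_int (round x)"
  have "pi * x = pi * t + of_int (round x) * pi" by (simp add: t_def algebra_simps)
  then have "sin (pi * x) = sin (pi * t) * cos (of_int (round x) * pi)"
    using sin_npi_int[of "round x"] by (simp add: sin_add mult.commute)
  moreover have "\<bar>cos (of_int (round x) * pi)\<bar> = 1"
    using sin_cos_squared_add[of "of_int (round x) * pi"] sin_npi_int[of "round x"]
    by (simp add: mult.commute abs_square_eq_1)
  ultimately have "\<bar>sin (pi * x)\<bar> = \<bar>sin (pi * t)\<bar>" by (simp add: abs_mult)
  also have "\<dots> = \<bar>sin (pi * \<bar>t\<bar>)\<bar>" by (simp add: abs_if)
  also have "\<dots> = sin (pi * \<bar>t\<bar>)"
  proof (rule abs_of_nonneg, rule sin_ge_zero)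
    have "\<bar>t\<bar> \<le> 1" using dist_nearest_int_le_half[of x] by (simp add: t_def dist_nearest_int_def)
    then show "pi * \<bar>t\<bar> \<le> pi" by (simp add: mult_left_le)
  qed simp
  finally show ?thesis by (simp add: t_def dist_nearest_int_def)
qed

lemma sin_ge_cubic:
  fixes x :: real
  assumes "0 \<le> x"
  shows "x - x ^ 3 / 6 \<le> sin x"
proof -
  have "\<bar>sin x - (\<Sum>m<3. sin_coeff m * x ^ m)\<bar> \<le> inverse (fact 3) * \<bar>x\<bar> ^ 3"
    by (rule Maclaurin_sin_bound)
  moreover have "(\<Sum>m<3. sin_coeff m * x ^ m) = x"
    by (simp add: sin_coeff_def numeral_3_eq_3)
  moreover have "inverse (fact 3) * \<bar>x\<bar> ^ 3 = x ^ 3 / 6"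
    using assms by (simp add: fact_numeral)
  ultimately show ?thesis by linarith
qed

text \<open>A weak Jordan inequality: since pi w \<le> 2, the cubic bound retains a third of pi w,
  and pi exceeds 3.\<close>

lemma sin_pi_ge:
  fixes w :: real
  assumes "0 \<le> w" "w \<le> 1 / 2"
  shows "w \<le> sin (pi * w)"
proof -
  have p: "3 < pi" "pi < 4" using pi_gt3 pi_less_4 by auto
  have pw: "0 \<le> pi * w" "pi * w \<le> 2" using assms p mult_mono[of pi 4 w "1/2"] by auto
  have "(pi * w)\<^sup>2 \<le> 2\<^sup>2" using pw by (intro power_mono)
  then have "(pi * w) * (1 / 3) \<le> (pi * w) * (1 - (pi * w)\<^sup>2 / 6)"
    using pw by (intro mult_left_mono) auto
  also have "\<dots> = pi * w - (pi * w) ^ 3 / 6" by (simp add: power2_eq_square power3_eq_cube algebra_simps)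
  also have "\<dots> \<le> sin (pi * w)" using pw by (intro sin_ge_cubic)
  finally have "pi * w * (1 / 3) \<le> sin (pi * w)" .
  moreover have "3 * w \<le> pi * w" using p assms by (intro mult_right_mono) auto
  ultimately show ?thesis by linarith
qed

text \<open>The double poles at 0 cancel, since x - sin x is only of cubic size. With x \<le> 4 sin
  x the difference is at most 16/3, rounded up to 6.\<close>

lemma inverse_sin_square_bounds:
  fixes w :: real
  assumes "0 < w" "w \<le> 1 / 2"
  shows "1 / (pi * w)\<^sup>2 \<le> 1 / (sin (pi * w))\<^sup>2" "1 / (sin (pi * w))\<^sup>2 - 1 / (pi * w)\<^sup>2 \<le> 6"
proof -
  define x where "x = pi * w"
  define s where "s = sin x"
  have x: "0 < x" using assms by (simp add: x_def)
  have s: "w \<le> s" using sin_pi_ge[of w] assms by (simp add: s_def x_def)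
  have s0: "0 < s" using s assms by linarith
  have sx: "s \<le> x" using sin_x_le_x[of x] x by (simp add: s_def)
  have "s\<^sup>2 \<le> x\<^sup>2" using sx s0 by (intro power_mono) auto
  then show "1 / (pi * w)\<^sup>2 \<le> 1 / (sin (pi * w))\<^sup>2"
    using s0 x unfolding x_def[symmetric] s_def[symmetric] by (intro divide_left_mono) auto
  have xs: "x - s \<le> x ^ 3 / 6" using sin_ge_cubic[of x] x by (simp add: s_def)
  have x4s: "x \<le> 4 * s" using s mult_mono[of pi 4 w s] pi_less_4 assms by (simp add: x_def)
  have "x\<^sup>2 - s\<^sup>2 = (x - s) * (x + s)" by (simp add: power2_eq_square algebra_simps)
  also have "\<dots> \<le> (x ^ 3 / 6) * (2 * x)" using xs sx s0 x by (intro mult_mono) auto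
  also have "\<dots> = x\<^sup>2 * (x\<^sup>2 / 3)" by (simp add: power2_eq_square power3_eq_cube)
  also have "\<dots> \<le> x\<^sup>2 * ((4 * s)\<^sup>2 / 3)"
    using x4s x by (intro mult_left_mono divide_right_mono power_mono) auto
  also have "\<dots> \<le> 6 * (x\<^sup>2 * s\<^sup>2)" by (simp add: power_mult_distrib)
  finally have "x\<^sup>2 - s\<^sup>2 \<le> 6 * (x\<^sup>2 * s\<^sup>2)" .
  then show "1 / (sin (pi * w))\<^sup>2 - 1 / (pi * w)\<^sup>2 \<le> 6"
    using x s0 unfolding x_def[symmetric] s_def[symmetric] by (simp add: field_simps)
qed

section \<open>Mean squares of Dirichlet kernels\<close>

lemma dirichlet_kernel:
  fixes \<theta> :: real
  shows "(1 + 2 * (\<Sum>k=1..N. cos (2 * real k * \<theta>))) * sin \<theta> = sin ((2 * real N + 1) * \<theta>)"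
proof (induction N)
  case (Suc N)
  have "(2 * real (Suc N) + 1) * \<theta> = 2 * real (Suc N) * \<theta> + \<theta>"
    "(2 * real N + 1) * \<theta> = 2 * real (Suc N) * \<theta> - \<theta>" by (simp_all add: algebra_simps)
  then have "sin ((2 * real (Suc N) + 1) * \<theta>) - sin ((2 * real N + 1) * \<theta>) = 2 * cos (2 * real (Suc N) * \<theta>) * sin \<theta>"
    by (simp only: sin_add sin_diff)
  with Suc show ?case by (simp add: algebra_simps)
qed simp

lemma sum_cos_odd:
  fixes \<phi> :: real
  shows "(\<Sum>N<n. cos ((2 * real N + 1) * \<phi>)) * (2 * sin \<phi>) = sin (2 * real n * \<phi>)"
proof (induction n)
  case (Suc n)
  have "2 * real (Suc n) * \<phi> = (2 * real n + 1) * \<phi> + \<phi>" "2 * real n * \<phi> = (2 * real n + 1) * \<phi> - \<phi>"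
    by (simp_all add: algebra_simps)
  then have "sin (2 * real (Suc n) * \<phi>) - sin (2 * real n * \<phi>) = cos ((2 * real n + 1) * \<phi>) * (2 * sin \<phi>)"
    by (simp only: sin_add sin_diff)
  with Suc show ?case by (simp add: algebra_simps)
qed simp

text \<open>At x = m\<alpha> this is V_m. The cosine sum replaces the quotient of sines, which would
  be degenerate at integers.\<close>

definition mean_kernel :: "nat \<Rightarrow> real \<Rightarrow> real" where
  "mean_kernel n x = (\<Sum>N<n. (1 + 2 * (\<Sum>k=1..N. cos (2 * pi * (real k * x))))\<^sup>2) / real n"

lemma mean_kernel_nonneg: "0 \<le> mean_kernel n x"
  unfolding mean_kernel_def by (intro divide_nonneg_nonneg sum_nonneg) auto

text \<open>The trivial bound, used in the tail, where no lower bound for the distance to the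
  nearest integer is at hand.\<close>

lemma mean_kernel_le: "mean_kernel n x \<le> 4 * (real n)\<^sup>2"
proof -
  have "(1 + 2 * (\<Sum>k=1..N. cos (2 * pi * (real k * x))))\<^sup>2 \<le> (2 * real n)\<^sup>2" if "N < n" for N
  proof -
    have "\<bar>\<Sum>k=1..N. cos (2 * pi * (real k * x))\<bar> \<le> (\<Sum>k=1..N. 1)"
      by (rule order_trans[OF sum_abs]) (intro sum_mono, simp)
    then have "\<bar>1 + 2 * (\<Sum>k=1..N. cos (2 * pi * (real k * x)))\<bar> \<le> 2 * real n" using that by simp
    then show ?thesis by (metis abs_le_square_iff abs_of_nonneg abs_ge_zero order_trans)
  qed
  then have "(\<Sum>N<n. (1 + 2 * (\<Sum>k=1..N. cos (2 * pi * (real k * x))))\<^sup>2) \<le> (\<Sum>N<n. (2 * real n)\<^sup>2)"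
    by (intro sum_mono) auto
  then show ?thesis unfolding mean_kernel_def
    by (cases "n = 0") (auto simp: field_simps power2_eq_square)
qed

lemma mean_kernel_times_sin_square:
  "mean_kernel n x * (sin (pi * x))\<^sup>2 = (\<Sum>N<n. (sin ((2 * real N + 1) * (pi * x)))\<^sup>2) / real n"
proof -
  have "(1 + 2 * (\<Sum>k=1..N. cos (2 * pi * (real k * x))))\<^sup>2 * (sin (pi * x))\<^sup>2
      = (sin ((2 * real N + 1) * (pi * x)))\<^sup>2" for N
    using dirichlet_kernel[where \<theta> = "pi * x" and N = N] by (simp add: mult_ac flip: power_mult_distrib)
  then show ?thesis unfolding mean_kernel_def by (simp add: sum_distrib_right)
qed

lemma mean_kernel_le_dist:
  assumes "x \<notin> \<int>"
  shows "mean_kernel n x \<le> 1 / (dist_nearest_int x)\<^sup>2"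
proof -
  let ?w = "dist_nearest_int x"
  have w: "0 < ?w" "?w \<le> 1 / 2" using assms dist_nearest_int_pos dist_nearest_int_le_half by auto
  have "?w\<^sup>2 \<le> (sin (pi * x))\<^sup>2"
  proof -
    have "\<bar>?w\<bar> \<le> \<bar>sin (pi * x)\<bar>" using sin_pi_ge[of ?w] w unfolding abs_sin_pi_eq by simp
    then show ?thesis by (simp only: abs_le_square_iff)
  qed
  then have "mean_kernel n x * ?w\<^sup>2 \<le> mean_kernel n x * (sin (pi * x))\<^sup>2"
    by (intro mult_left_mono mean_kernel_nonneg)
  also have "\<dots> = (\<Sum>N<n. (sin ((2 * real N + 1) * (pi * x)))\<^sup>2) / real n"
    by (rule mean_kernel_times_sin_square)
  also have "\<dots> \<le> (\<Sum>N<n. 1) / real n"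
    by (intro divide_right_mono sum_mono) (simp_all add: abs_square_le_1)
  also have "\<dots> \<le> 1" by simp
  finally show ?thesis using w by (simp add: field_simps)
qed

text \<open>Halving the angle in the numerator splits the kernel into 1 / (2 sin^2) and an
  oscillating part T / sin^2. The first differs from the main term by at most 3; the second is
  controlled by the closed form of the cosine sum, up to 8.\<close>

lemma mean_kernel_asymp:
  assumes x: "x \<notin> \<int>" and n: "0 < n"
  defines "w \<equiv> dist_nearest_int x"
  shows "\<bar>mean_kernel n x - 1 / (2 * pi\<^sup>2 * w\<^sup>2)\<bar> \<le> 11 + 1 / w\<^sup>2 * min 1 (1 / (real n * w))"
proof -
  have w: "0 < w" "w \<le> 1 / 2" using x dist_nearest_int_pos dist_nearest_int_le_half by (auto simp: w_def)
  define s where "s = sin (pi * w)"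
  define T where "T = (\<Sum>N<n. cos ((2 * real N + 1) * (2 * (pi * x)))) / (2 * real n)"
  have ws: "w \<le> s" using sin_pi_ge[of w] w by (simp add: s_def)
  have s0: "0 < s" using ws w by linarith
  have s2: "(sin (pi * x))\<^sup>2 = s\<^sup>2" unfolding s_def w_def abs_sin_pi_eq[symmetric] by simp
  have "(sin a)\<^sup>2 = 1 / 2 - cos (2 * a) / 2" for a :: real
    using cos_double_sin[of a] by linarith
  then have "(\<Sum>N<n. (sin ((2 * real N + 1) * (pi * x)))\<^sup>2) = real n / 2 - (\<Sum>N<n. cos ((2 * real N + 1) * (2 * (pi * x)))) / 2"
    by (simp add: sum_subtractf sum_divide_distrib mult_ac)
  then have "mean_kernel n x * s\<^sup>2 = 1 / 2 - T"
    using mean_kernel_times_sin_square[of n x] n unfolding s2 T_def by (simp add: field_simps)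
  then have V: "mean_kernel n x = 1 / (2 * s\<^sup>2) - T / s\<^sup>2" using s0 by (simp add: field_simps)
  have T1: "\<bar>T\<bar> \<le> 1 / 2"
  proof -
    have "\<bar>\<Sum>N<n. cos ((2 * real N + 1) * (2 * (pi * x)))\<bar> \<le> (\<Sum>N<n. 1)"
      by (rule order_trans[OF sum_abs]) (intro sum_mono, simp)
    then show ?thesis using n by (simp add: T_def abs_divide field_simps)
  qed
  have sw: "1 / s\<^sup>2 \<le> 1 / w\<^sup>2" using ws w by (intro divide_left_mono power_mono) auto
  have main: "\<bar>T\<bar> / s\<^sup>2 \<le> 8 + 1 / w\<^sup>2 * min 1 (1 / (real n * w))"
  \<comment> \<open>For w \<le> 1/4 the cosine at pi x is bounded away from 0, so sin(2 pi x), the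
    denominator of the closed form, is at least w. For larger w it may be tiny, but then
    \<open>1 / s\<^sup>2\<close> is at most 16 and the trivial bound on T suffices.\<close>
  proof (cases "w \<le> 1 / 4")
    case True
    have "s \<le> sin (pi / 4)" unfolding s_def
    proof (rule sin_monotone_2pi_le)
      have "0 \<le> pi * w" using w by simp
      then show "- (pi / 2) \<le> pi * w" using pi_gt_zero by linarith
    qed (use True in auto)
    then have "s\<^sup>2 \<le> (sin (pi / 4))\<^sup>2" using s0 by (intro power_mono) auto
    then have "s\<^sup>2 \<le> 1 / 2" by (simp add: sin_45 power_divide)
    then have "1 / 4 \<le> (cos (pi * x))\<^sup>2" using sin_cos_squared_add[of "pi * x"] s2 by linarith
    then have "(1 / 2)\<^sup>2 \<le> (cos (pi * x))\<^sup>2" by (simp add: power2_eq_square)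
    then have c: "1 / 2 \<le> \<bar>cos (pi * x)\<bar>" by (metis abs_le_square_iff abs_of_nonneg zero_le_divide_1_iff zero_le_numeral)
    have "w * 1 \<le> s * (2 * \<bar>cos (pi * x)\<bar>)" using ws c w s0 by (intro mult_mono) auto
    also have "\<dots> = \<bar>sin (2 * (pi * x))\<bar>"
      unfolding sin_double abs_mult using abs_sin_pi_eq[of x] by (simp add: s_def w_def)
    finally have w2: "w \<le> \<bar>sin (2 * (pi * x))\<bar>" by simp
    have "T * (4 * real n * sin (2 * (pi * x))) = (\<Sum>N<n. cos ((2 * real N + 1) * (2 * (pi * x)))) * (2 * sin (2 * (pi * x)))"
      using n by (simp add: T_def)
    also have "\<dots> = sin (2 * real n * (2 * (pi * x)))" by (rule sum_cos_odd)
    finally have "\<bar>T\<bar> * (4 * real n * \<bar>sin (2 * (pi * x))\<bar>) = \<bar>sin (2 * real n * (2 * (pi * x)))\<bar>"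
      by (metis abs_mult abs_of_nonneg of_nat_0_le_iff abs_numeral)
    also have "\<dots> \<le> 1" by simp
    finally have "\<bar>T\<bar> * (4 * real n * \<bar>sin (2 * (pi * x))\<bar>) \<le> 1" .
    moreover have "\<bar>T\<bar> * (real n * w) \<le> \<bar>T\<bar> * (4 * real n * \<bar>sin (2 * (pi * x))\<bar>)"
    proof (intro mult_left_mono)
      have "real n * w \<le> real n * \<bar>sin (2 * (pi * x))\<bar>" using w2 by (intro mult_left_mono) auto
      moreover have "0 \<le> real n * \<bar>sin (2 * (pi * x))\<bar>" by simp
      ultimately show "real n * w \<le> 4 * real n * \<bar>sin (2 * (pi * x))\<bar>" by linarith
    qed simp
    ultimately have "\<bar>T\<bar> \<le> 1 / (real n * w)" using n w by (simp add: field_simps)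
    then have "\<bar>T\<bar> \<le> min 1 (1 / (real n * w))" using T1 by simp
    then have "1 / s\<^sup>2 * \<bar>T\<bar> \<le> 1 / w\<^sup>2 * min 1 (1 / (real n * w))"
      using sw by (intro mult_mono) auto
    then show ?thesis by simp
  next
    case False
    then have "(1 / 4)\<^sup>2 \<le> w\<^sup>2" by (intro power_mono) auto
    then have "1 / w\<^sup>2 \<le> 1 / (1 / 4)\<^sup>2" using w by (intro divide_left_mono) auto
    then have "1 / s\<^sup>2 \<le> 16" using sw by (simp add: power2_eq_square)
    then have "1 / s\<^sup>2 * \<bar>T\<bar> \<le> 16 * (1 / 2)" using T1 by (intro mult_mono) auto
    moreover have "0 \<le> 1 / w\<^sup>2 * min 1 (1 / (real n * w))" using w by simp
    ultimately show ?thesis by simp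
  qed
  have "mean_kernel n x - 1 / (2 * pi\<^sup>2 * w\<^sup>2) = 1 / 2 * (1 / s\<^sup>2 - 1 / (pi * w)\<^sup>2) - T / s\<^sup>2"
    unfolding V by (simp add: power_mult_distrib right_diff_distrib)
  also have "\<bar>\<dots>\<bar> \<le> 1 / 2 * 6 + \<bar>T\<bar> / s\<^sup>2"
    using inverse_sin_square_bounds[OF w] unfolding s_def[symmetric]
    by (intro order_trans[OF abs_triangle_ineq4] add_mono) auto
  finally show ?thesis using main by linarith
qed

section \<open>Sums over well-spaced points\<close>

lemma sum_inverse_squares_le_2:
  assumes "finite A" "0 \<notin> A"
  shows "(\<Sum>i\<in>A. 1 / (real i)\<^sup>2) \<le> 2"
proof -
  have s: "(\<lambda>n. 1 / (real (Suc n))\<^sup>2) sums (pi\<^sup>2 / 6)"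
    using inverse_squares_sums by (simp add: add.commute)
  have "(\<Sum>i\<in>A. 1 / (real i)\<^sup>2) = (\<Sum>i\<in>(\<lambda>i. i - 1) ` A. 1 / (real (Suc i))\<^sup>2)"
  proof (subst sum.reindex)
    have pos: "0 < i" if "i \<in> A" for i using that assms(2) by (cases "i = 0") auto
    show "inj_on (\<lambda>i. i - 1) A"
    proof (rule inj_onI)
      fix i j assume "i \<in> A" "j \<in> A" "i - 1 = j - 1"
      with pos[of i] pos[of j] show "i = j" by linarith
    qed
    show "(\<Sum>i\<in>A. 1 / (real i)\<^sup>2) = sum ((\<lambda>i. 1 / (real (Suc i))\<^sup>2) \<circ> (\<lambda>i. i - 1)) A"
      using pos by (intro sum.cong refl) (simp del: of_nat_Suc)
  qed
  also have "\<dots> \<le> (\<Sum>n. 1 / (real (Suc n))\<^sup>2)"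
    using s assms by (intro sum_le_suminf) (auto simp: sums_iff)
  also have "\<dots> = pi\<^sup>2 / 6" using s by (simp add: sums_iff)
  also have "\<dots> \<le> 2"
  proof -
    have "pi\<^sup>2 \<le> (3.2)\<^sup>2" using pi_approx by (intro power_mono) auto
    then show ?thesis by (simp add: power2_eq_square)
  qed
  finally show ?thesis .
qed

text \<open>By injectivity at most one term has index 0, and it costs X; the others carry distinct
  positive indices and are compared with the series of inverse squares.\<close>

lemma sum_injective_bound:
  fixes g :: "nat \<Rightarrow> real" and i :: "nat \<Rightarrow> nat"
  assumes I: "finite I" "inj_on i I" and X: "0 \<le> X" "\<And>m. m \<in> I \<Longrightarrow> g m \<le> X"
    and g: "\<And>m. m \<in> I \<Longrightarrow> i m \<noteq> 0 \<Longrightarrow> g m \<le> Y / (real (i m))\<^sup>2" and Y: "0 \<le> Y"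
  shows "sum g I \<le> X + 2 * Y"
proof -
  let ?A = "i ` I - {0}"
  have "sum g I \<le> (\<Sum>m\<in>I. if i m = 0 then X else Y / (real (i m))\<^sup>2)"
    using X g by (intro sum_mono) auto
  also have "\<dots> = (\<Sum>j\<in>i ` I. if j = 0 then X else Y / (real j)\<^sup>2)"
    using I by (subst sum.reindex) auto
  also have "\<dots> \<le> (\<Sum>j\<in>insert 0 ?A. if j = 0 then X else Y / (real j)\<^sup>2)"
    using I X Y by (intro sum_mono2) auto
  also have "\<dots> = X + (\<Sum>j\<in>?A. Y * (1 / (real j)\<^sup>2))"
    using I by (subst sum.insert) (auto intro!: sum.cong)
  also have "\<dots> = X + Y * (\<Sum>j\<in>?A. 1 / (real j)\<^sup>2)" by (simp only: sum_distrib_left)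
  also have "\<dots> \<le> X + Y * 2"
    using I Y by (intro add_left_mono mult_left_mono sum_inverse_squares_le_2) auto
  finally show ?thesis by simp
qed

text \<open>
  Signed distances to the nearest integer that have the same sign and are at least \<open>\<delta>\<close> apart occupy
  different cells \<open>[j\<delta>, (j+1)\<delta>)\<close>, so only one term on each side of \<open>0\<close> needs the bound \<open>X\<close>.
\<close>

lemma sum_well_spaced:
  fixes g :: "nat \<Rightarrow> real"
  assumes \<delta>: "0 < \<delta>" "\<And>h. 1 \<le> h \<Longrightarrow> h < M \<Longrightarrow> \<delta> \<le> dist_nearest_int (real h * \<alpha>)"
    and X: "0 \<le> X" "\<And>m. m \<in> {a..<a + M} \<Longrightarrow> g m \<le> X"
    and g: "\<And>m. m \<in> {a..<a + M} \<Longrightarrow> g m \<le> 1 / (dist_nearest_int (real m * \<alpha>))\<^sup>2"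
  shows "sum g {a..<a + M} \<le> 2 * X + 4 / \<delta>\<^sup>2"
proof -
  define t where "t m = real m * \<alpha> - of_int (round (real m * \<alpha>))" for m :: nat
  define i where "i m = nat \<lfloor>\<bar>t m\<bar> / \<delta>\<rfloor>" for m
  \<comment> \<open>The difference of the signed distances is congruent to (m' - m)\<alpha> modulo
    1, and 0 < m' - m < M.\<close>
  have spaced: "\<delta> \<le> \<bar>t m' - t m\<bar>" if "m < m'" "m \<in> {a..<a + M}" "m' \<in> {a..<a + M}" for m m'
  proof -
    have "\<delta> \<le> dist_nearest_int (real (m' - m) * \<alpha>)" using that by (intro \<delta>(2)) auto
    also have "\<dots> \<le> \<bar>real (m' - m) * \<alpha> - of_int (round (real m' * \<alpha>) - round (real m * \<alpha>))\<bar>"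
      by (rule dist_nearest_int_le)
    also have "\<dots> = \<bar>t m' - t m\<bar>" using that by (simp add: t_def of_nat_diff algebra_simps)
    finally show ?thesis .
  qed
  have close: "\<bar>\<bar>t m\<bar> - \<bar>t m'\<bar>\<bar> < \<delta>" if "i m = i m'" for m m'
  proof -
    have "0 \<le> \<lfloor>\<bar>t k\<bar> / \<delta>\<rfloor>" for k using \<delta>(1) by simp
    then have "\<lfloor>\<bar>t m\<bar> / \<delta>\<rfloor> = \<lfloor>\<bar>t m'\<bar> / \<delta>\<rfloor>" using that unfolding i_def by (metis int_nat_eq)
    then have "\<bar>\<bar>t m\<bar> / \<delta> - \<bar>t m'\<bar> / \<delta>\<bar> < 1" by linarith
    then have "\<bar>\<bar>t m\<bar> - \<bar>t m'\<bar>\<bar> / \<delta> < 1" using \<delta>(1) by (simp add: diff_divide_distrib[symmetric])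
    then show ?thesis using \<delta>(1) by simp
  qed
  have inj: "inj_on i I" if I: "I \<subseteq> {a..<a + M}" and sign: "(\<forall>m\<in>I. 0 \<le> t m) \<or> (\<forall>m\<in>I. t m < 0)" for I
  proof (rule linorder_inj_onI)
    fix m m' assume m: "m < m'" "m \<in> I" "m' \<in> I"
    show "i m \<noteq> i m'"
    proof
      assume "i m = i m'"
      then have "\<bar>\<bar>t m\<bar> - \<bar>t m'\<bar>\<bar> < \<delta>" by (rule close)
      moreover have "\<delta> \<le> \<bar>t m' - t m\<bar>" using m I by (intro spaced) auto
      moreover have "\<bar>\<bar>t m\<bar> - \<bar>t m'\<bar>\<bar> = \<bar>t m' - t m\<bar>"
      proof -
        have "(0 \<le> t m \<and> 0 \<le> t m') \<or> (t m < 0 \<and> t m' < 0)" using sign m(2,3) by blast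
        then show ?thesis by linarith
      qed
      ultimately show False by simp
    qed
  qed auto
  have bound: "g m \<le> (1 / \<delta>\<^sup>2) / (real (i m))\<^sup>2" if "m \<in> {a..<a + M}" "i m \<noteq> 0" for m
  proof -
    have "real (i m) = of_int \<lfloor>\<bar>t m\<bar> / \<delta>\<rfloor>" using \<delta>(1) by (simp add: i_def)
    also have "\<dots> \<le> \<bar>t m\<bar> / \<delta>" by simp
    finally have le: "real (i m) * \<delta> \<le> \<bar>t m\<bar>" using \<delta>(1) by (simp add: field_simps)
    have pos: "0 < real (i m) * \<delta>" using that(2) \<delta>(1) by simp
    have "g m \<le> 1 / \<bar>t m\<bar>\<^sup>2" using g[OF that(1)] by (simp add: dist_nearest_int_def t_def)
    also have "\<dots> \<le> 1 / (real (i m) * \<delta>)\<^sup>2"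
    proof (intro divide_left_mono power_mono)
      have "0 < \<bar>t m\<bar>" using le pos by linarith
      then show "0 < \<bar>t m\<bar>\<^sup>2 * (real (i m) * \<delta>)\<^sup>2" by (rule mult_pos_pos[OF zero_less_power zero_less_power[OF pos]])
    qed (use le pos in linarith)+
    finally show ?thesis by (simp add: power_mult_distrib mult.commute)
  qed
  let ?P = "{m\<in>{a..<a + M}. 0 \<le> t m}" and ?N = "{m\<in>{a..<a + M}. t m < 0}"
  have "{a..<a + M} = ?P \<union> ?N" by auto
  then have "sum g {a..<a + M} = sum g (?P \<union> ?N)" by (rule arg_cong)
  also have "\<dots> = sum g ?P + sum g ?N" by (rule sum.union_disjoint) auto
  also have "\<dots> \<le> (X + 2 * (1 / \<delta>\<^sup>2)) + (X + 2 * (1 / \<delta>\<^sup>2))"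
    by (intro add_mono sum_injective_bound[of _ i] inj) (use X bound in auto)
  finally show ?thesis by simp
qed

section \<open>Dyadic blocks for the head and long blocks for the tail\<close>

lemma sum_min_geometric_le:
  fixes K J :: nat
  shows "(\<Sum>l<K. min 1 ((2::real) ^ J / 2 ^ l)) \<le> real J + 2"
proof -
  have le: "(\<Sum>l<K. min 1 ((2::real) ^ J / 2 ^ l)) \<le> real K" for K
  proof -
    have "(\<Sum>l<K. min 1 ((2::real) ^ J / 2 ^ l)) \<le> (\<Sum>l<K. 1)" by (intro sum_mono) simp
    then show ?thesis by simp
  qed
  show ?thesis
  proof (cases "K \<le> J")
    case True
    then show ?thesis using le[of K] by simp
  next
    case False
    then have "J \<le> K" by simp
    \<comment> \<open>The subtracted quantity is the remaining geometric tail; keeping it makes the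
      bound inductive.\<close>
    then have "(\<Sum>l<K. min 1 ((2::real) ^ J / 2 ^ l)) \<le> real J + 2 - 2 * (2 ^ J / 2 ^ K)"
    proof (induction K rule: dec_induct)
      case base
      show ?case using le[of J] by simp
    next
      case (step K)
      have "min 1 ((2::real) ^ J / 2 ^ K) \<le> 2 ^ J / 2 ^ K" by simp
      moreover have "2 * ((2::real) ^ J / 2 ^ Suc K) = 2 ^ J / 2 ^ K" by simp
      ultimately show ?case using step.IH by simp
    qed
    moreover have "0 \<le> 2 * ((2::real) ^ J / 2 ^ K)" by simp
    ultimately show ?thesis by linarith
  qed
qed

lemma sum_dyadic:
  fixes f :: "nat \<Rightarrow> real"
  shows "sum f {1..<2 ^ K} = (\<Sum>i<K. sum f {2 ^ i..<2 ^ i + 2 ^ i})"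
proof (induction K)
  case (Suc K)
  have "sum f {1..<2 ^ Suc K} = sum f {1..<2 ^ K} + sum f {2 ^ K..<2 ^ Suc K}"
    by (rule sum.atLeastLessThan_concat[symmetric]) auto
  with Suc show ?case by (simp add: mult_2)
qed simp

text \<open>Differences of indices in the block are below M, which gives the spacing 1 /
  (M\<Lambda>); the indices themselves are below 2M, which bounds a single term by (2M\<Lambda>)^2.
  Then 2 * 4 + 4 = 12.\<close>

lemma sum_inverse_square_dyadic:
  assumes \<Lambda>: "1 \<le> \<Lambda>" and M: "1 \<le> M"
    and low: "\<And>h. 1 \<le> h \<Longrightarrow> h < 2 * M \<Longrightarrow> 1 / (real h * \<Lambda>) \<le> dist_nearest_int (real h * \<alpha>)"
  shows "(\<Sum>m\<in>{M..<M + M}. 1 / (dist_nearest_int (real m * \<alpha>))\<^sup>2) \<le> 12 * (real M * \<Lambda>)\<^sup>2"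
proof -
  have low': "1 / (c * \<Lambda>) \<le> dist_nearest_int (real h * \<alpha>)" if "1 \<le> h" "h < 2 * M" "real h \<le> c" for h c
  proof -
    have "1 / (c * \<Lambda>) \<le> 1 / (real h * \<Lambda>)"
      using that \<Lambda> by (intro divide_left_mono mult_right_mono mult_pos_pos) auto
    with low[OF that(1,2)] show ?thesis by linarith
  qed
  have "(\<Sum>m\<in>{M..<M + M}. 1 / (dist_nearest_int (real m * \<alpha>))\<^sup>2)
      \<le> 2 * (2 * real M * \<Lambda>)\<^sup>2 + 4 / (1 / (real M * \<Lambda>))\<^sup>2"
  proof (rule sum_well_spaced)
    show "0 < 1 / (real M * \<Lambda>)" using M \<Lambda> by simp
    show "1 / (real M * \<Lambda>) \<le> dist_nearest_int (real h * \<alpha>)" if "1 \<le> h" "h < M" for h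
      using that by (intro low') auto
    show "1 / (dist_nearest_int (real m * \<alpha>))\<^sup>2 \<le> (2 * real M * \<Lambda>)\<^sup>2" if "m \<in> {M..<M + M}" for m
    proof -
      have pos: "0 < 1 / (2 * real M * \<Lambda>)" using M \<Lambda> by simp
      have "1 / (2 * real M * \<Lambda>) \<le> dist_nearest_int (real m * \<alpha>)" using that M by (intro low') auto
      then have "1 / (dist_nearest_int (real m * \<alpha>))\<^sup>2 \<le> 1 / (1 / (2 * real M * \<Lambda>))\<^sup>2"
        using pos by (intro divide_left_mono power_mono mult_pos_pos zero_less_power) linarith+
      then show ?thesis by (simp add: power_divide)
    qed
  qed auto
  also have "\<dots> = 12 * (real M * \<Lambda>)\<^sup>2" by (simp add: power_divide power_mult_distrib)
  finally show ?thesis .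
qed

text \<open>The minimum gains a factor 2 for every dyadic step down from n, except in the roughly
  log \<Lambda> topmost blocks, where it may be 1.\<close>

lemma sum_head_error:
  assumes n: "1 \<le> n" and \<Lambda>: "1 \<le> \<Lambda>"
    and low: "\<And>h. 1 \<le> h \<Longrightarrow> h \<le> 2 * n \<Longrightarrow> 1 / (real h * \<Lambda>) \<le> dist_nearest_int (real h * \<alpha>)"
  defines "w \<equiv> \<lambda>m. dist_nearest_int (real m * \<alpha>)"
  shows "(\<Sum>m=1..n. 1 / ((real m)\<^sup>2 * (w m)\<^sup>2) * min 1 (1 / (real n * w m))) \<le> 12 * \<Lambda>\<^sup>2 * (2 * ln \<Lambda> + 5)"
proof -
  let ?f = "\<lambda>m. 1 / ((real m)\<^sup>2 * (w m)\<^sup>2) * min 1 (1 / (real n * w m))"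
  have w0: "0 \<le> w m" for m by (simp add: w_def dist_nearest_int_nonneg)
  have f0: "0 \<le> ?f m" for m using w0[of m] by simp
  obtain K where K: "2 ^ K \<le> n" "n < 2 ^ Suc K"
    using ex_power_ivl1[of 2 n] n by auto
  \<comment> \<open>J is taken so that 2\<Lambda> \<le> 2^J; then 1 / w is at most M 2^J throughout
    a block starting at M.\<close>
  define J where "J = nat \<lceil>log 2 (2 * \<Lambda>)\<rceil>"
  have log0: "0 \<le> log 2 (2 * \<Lambda>)" using \<Lambda> by simp
  have "2 * \<Lambda> = 2 powr (log 2 (2 * \<Lambda>))" using \<Lambda> by simp
  also have "\<dots> \<le> 2 powr (real J)" unfolding J_def by (intro powr_mono) linarith+
  also have "\<dots> = 2 ^ J" by (simp add: powr_realpow)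
  finally have J: "2 * \<Lambda> \<le> 2 ^ J" .
  have block: "sum ?f {2 ^ i..<2 ^ i + 2 ^ i} \<le> 12 * \<Lambda>\<^sup>2 * min 1 (2 ^ J / 2 ^ (K - i))" if i: "i \<le> K" for i
  proof -
    define M :: nat where "M = 2 ^ i"
    have M: "1 \<le> M" by (simp add: M_def)
    have "M \<le> 2 ^ K" unfolding M_def using i by (intro power_increasing) auto
    then have Mn: "M \<le> n" using K by simp
    \<comment> \<open>The topmost block reaches up to 2M - 1, possibly beyond n; hence the
      hypothesis covers indices up to 2n.\<close>
    have low2: "1 / (real h * \<Lambda>) \<le> dist_nearest_int (real h * \<alpha>)" if "1 \<le> h" "h < 2 * M" for h
      using that Mn by (intro low) auto
    define c where "c = min 1 (2 ^ J / 2 ^ (K - i) :: real)"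
    have c0: "0 \<le> c" by (simp add: c_def)
    have "?f m \<le> c / (real M)\<^sup>2 * (1 / (w m)\<^sup>2)" if m: "m \<in> {M..<M + M}" for m
    proof -
      have m1: "1 \<le> m" using m M by simp
      have "1 / (real m * \<Lambda>) \<le> w m" unfolding w_def using m M by (intro low2) auto
      moreover have pos: "0 < 1 / (real m * \<Lambda>)" using m1 \<Lambda> by simp
      ultimately have wm: "0 < w m" by linarith
      have "1 / w m \<le> real m * \<Lambda>"
        using \<open>1 / (real m * \<Lambda>) \<le> w m\<close> wm m1 \<Lambda> by (simp add: field_simps)
      also have "\<dots> \<le> (2 * real M) * \<Lambda>" using m \<Lambda> by (intro mult_right_mono) auto
      also have "\<dots> \<le> real M * 2 ^ J" using J mult_left_mono[of "2 * \<Lambda>" "2 ^ J" "real M"] by simp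
      finally have "1 / w m / real n \<le> real M * 2 ^ J / real n" by (intro divide_right_mono) auto
      also have "\<dots> \<le> real M * 2 ^ J / 2 ^ K"
        using K(1) n by (intro divide_left_mono) (auto simp flip: of_nat_power)
      also have "\<dots> = 2 ^ J / 2 ^ (K - i)"
      proof -
        have "(2::real) ^ K = 2 ^ i * 2 ^ (K - i)" using i by (simp flip: power_add)
        then show ?thesis by (simp add: M_def)
      qed
      finally have "1 / (real n * w m) \<le> 2 ^ J / 2 ^ (K - i)" by (simp add: mult.commute)
      then have "min 1 (1 / (real n * w m)) \<le> c" unfolding c_def by (intro min.mono) auto
      moreover have "1 / ((real m)\<^sup>2 * (w m)\<^sup>2) \<le> 1 / ((real M)\<^sup>2 * (w m)\<^sup>2)"
        using m M m1 wm by (intro divide_left_mono mult_right_mono power_mono mult_pos_pos) auto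
      ultimately have "?f m \<le> 1 / ((real M)\<^sup>2 * (w m)\<^sup>2) * c"
        using wm by (intro mult_mono) auto
      then show ?thesis by (simp add: mult.commute)
    qed
    then have "sum ?f {M..<M + M} \<le> (\<Sum>m\<in>{M..<M + M}. c / (real M)\<^sup>2 * (1 / (w m)\<^sup>2))"
      by (rule sum_mono)
    also have "\<dots> = c / (real M)\<^sup>2 * (\<Sum>m\<in>{M..<M + M}. 1 / (w m)\<^sup>2)" by (simp only: sum_distrib_left)
    also have "\<dots> \<le> c / (real M)\<^sup>2 * (12 * (real M * \<Lambda>)\<^sup>2)"
      unfolding w_def using c0 by (intro mult_left_mono sum_inverse_square_dyadic \<Lambda> M low2) auto
    also have "\<dots> = 12 * \<Lambda>\<^sup>2 * c" using M by (simp add: power_mult_distrib)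
    finally show ?thesis by (simp only: M_def c_def)
  qed
  have "sum ?f {1..n} \<le> sum ?f {1..<2 ^ Suc K}"
    using K(2) f0 by (intro sum_mono2) auto
  also have "\<dots> = (\<Sum>i<Suc K. sum ?f {2 ^ i..<2 ^ i + 2 ^ i})" by (rule sum_dyadic)
  also have "\<dots> \<le> (\<Sum>i<Suc K. 12 * \<Lambda>\<^sup>2 * min 1 (2 ^ J / 2 ^ (K - i)))"
    by (intro sum_mono block) auto
  also have "\<dots> = 12 * \<Lambda>\<^sup>2 * (\<Sum>i<Suc K. min 1 (2 ^ J / 2 ^ (K - i)))" by (simp only: sum_distrib_left)
  \<comment> \<open>Reversing the order numbers the blocks by their depth below the top one.\<close>
  also have "(\<Sum>i<Suc K. min 1 ((2::real) ^ J / 2 ^ (K - i))) = (\<Sum>l<Suc K. min 1 (2 ^ J / 2 ^ l))"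
    using sum.nat_diff_reindex[of "\<lambda>l. min 1 ((2::real) ^ J / 2 ^ l)" "Suc K"] by simp
  also have "12 * \<Lambda>\<^sup>2 * \<dots> \<le> 12 * \<Lambda>\<^sup>2 * (2 * ln \<Lambda> + 5)"
  proof (intro mult_left_mono)
    have "real J \<le> log 2 (2 * \<Lambda>) + 1" unfolding J_def using log0 by linarith
    also have "log 2 (2 * \<Lambda>) = 1 + ln \<Lambda> / ln 2" using \<Lambda> ln_mult[of 2 \<Lambda>] by (simp add: log_def add_divide_distrib)
    also have "ln \<Lambda> / ln 2 \<le> ln \<Lambda> / (1 / 2)"
      using \<Lambda> ln2_ge_two_thirds by (intro divide_left_mono) auto
    finally have "real J \<le> 2 * ln \<Lambda> + 2" by simp
    with sum_min_geometric_le[where K = "Suc K" and J = J]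
    show "(\<Sum>l<Suc K. min 1 ((2::real) ^ J / 2 ^ l)) \<le> 2 * ln \<Lambda> + 5" by linarith
  qed simp
  finally show ?thesis .
qed

text \<open>In the block of n indices from nj on, spacing bounds the sum of the kernels by n^2 (8 +
  4\<Lambda>^2), while the weights are at most 1 / (nj)^2. The blocks therefore sum like 1 / j^2,
  uniformly in J.\<close>

lemma sum_tail_blocks:
  assumes irr: "\<alpha> \<notin> \<rat>" and n: "1 \<le> n" and \<Lambda>: "1 \<le> \<Lambda>"
    and low: "\<And>h. 1 \<le> h \<Longrightarrow> h \<le> n \<Longrightarrow> 1 / (real h * \<Lambda>) \<le> dist_nearest_int (real h * \<alpha>)"
  shows "\<bar>\<Sum>m\<in>{n..<n * Suc J}. (mean_kernel n (real (Suc m) * \<alpha>) - 1) / (2 * pi\<^sup>2 * (real (Suc m))\<^sup>2)\<bar> \<le> 26 * \<Lambda>\<^sup>2"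
proof -
  let ?V = "\<lambda>m. mean_kernel n (real m * \<alpha>)"
  let ?t = "\<lambda>m. (?V (Suc m) - 1) / (2 * pi\<^sup>2 * (real (Suc m))\<^sup>2)"
  have block: "(\<Sum>m\<in>{n * j..<n * Suc j}. \<bar>?t m\<bar>) \<le> 13 * \<Lambda>\<^sup>2 * (1 / (real j)\<^sup>2)" if j: "1 \<le> j" for j
  proof -
    have tm: "\<bar>?t m\<bar> \<le> 1 / (real (n * j))\<^sup>2 * (?V (Suc m) + 1)" if "n * j \<le> m" for m
    proof -
      have "1 \<le> pi\<^sup>2" using pi_gt3 by (simp add: one_le_power)
      then have "1 * (real (n * j))\<^sup>2 \<le> (2 * pi\<^sup>2) * (real (Suc m))\<^sup>2"
        using that by (intro mult_mono power_mono) (auto simp flip: of_nat_mult of_nat_Suc)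
      moreover have "\<bar>?V (Suc m) - 1\<bar> \<le> ?V (Suc m) + 1" using mean_kernel_nonneg[of n "real (Suc m) * \<alpha>"] by linarith
      ultimately have "\<bar>?V (Suc m) - 1\<bar> / (2 * pi\<^sup>2 * (real (Suc m))\<^sup>2) \<le> (?V (Suc m) + 1) / (real (n * j))\<^sup>2"
        using n j by (intro frac_le) auto
      then show ?thesis by (simp add: abs_mult)
    qed
    have "(\<Sum>m\<in>{n * j..<n * Suc j}. ?V (Suc m)) = (\<Sum>m\<in>{Suc (n * j)..<Suc (n * j) + n}. ?V m)"
      by (subst sum.shift_bounds_Suc_ivl[symmetric]) (simp add: add.commute)
    also have "\<dots> \<le> 2 * (4 * (real n)\<^sup>2) + 4 / (1 / (real n * \<Lambda>))\<^sup>2"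
    proof (rule sum_well_spaced)
      show "0 < 1 / (real n * \<Lambda>)" using n \<Lambda> by simp
      show "1 / (real n * \<Lambda>) \<le> dist_nearest_int (real h * \<alpha>)" if "1 \<le> h" "h < n" for h
      proof -
        have "1 / (real n * \<Lambda>) \<le> 1 / (real h * \<Lambda>)"
          using that \<Lambda> by (intro divide_left_mono mult_right_mono mult_pos_pos) auto
        with low[of h] that show ?thesis by linarith
      qed
      show "?V m \<le> 1 / (dist_nearest_int (real m * \<alpha>))\<^sup>2" if "m \<in> {Suc (n * j)..<Suc (n * j) + n}" for m
        using that by (intro mean_kernel_le_dist int_mult_irrational_notin_Ints irr) auto
    qed (auto intro: mean_kernel_le)
    also have "\<dots> = (real n)\<^sup>2 * (8 + 4 * \<Lambda>\<^sup>2)" by (simp add: power_divide power_mult_distrib algebra_simps)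
    finally have sV: "(\<Sum>m\<in>{n * j..<n * Suc j}. ?V (Suc m)) \<le> (real n)\<^sup>2 * (8 + 4 * \<Lambda>\<^sup>2)" .
    have "(\<Sum>m\<in>{n * j..<n * Suc j}. \<bar>?t m\<bar>) \<le> (\<Sum>m\<in>{n * j..<n * Suc j}. 1 / (real (n * j))\<^sup>2 * (?V (Suc m) + 1))"
      by (intro sum_mono tm) simp
    also have "\<dots> = 1 / (real (n * j))\<^sup>2 * ((\<Sum>m\<in>{n * j..<n * Suc j}. ?V (Suc m)) + real n)"
      by (simp only: sum_distrib_left[symmetric] sum.distrib) simp
    also have "\<dots> \<le> 1 / (real (n * j))\<^sup>2 * ((real n)\<^sup>2 * (13 * \<Lambda>\<^sup>2))"
    proof (intro mult_left_mono)
      have "1 \<le> \<Lambda>\<^sup>2" using \<Lambda> by (simp add: one_le_power)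
      then have "(real n)\<^sup>2 * (8 + 4 * \<Lambda>\<^sup>2 + 1) \<le> (real n)\<^sup>2 * (13 * \<Lambda>\<^sup>2)" by (intro mult_left_mono) auto
      moreover have "real n \<le> (real n)\<^sup>2" using n by (simp add: power2_eq_square)
      ultimately show "(\<Sum>m\<in>{n * j..<n * Suc j}. ?V (Suc m)) + real n \<le> (real n)\<^sup>2 * (13 * \<Lambda>\<^sup>2)"
        using sV unfolding distrib_left by linarith
    qed simp
    also have "\<dots> = 13 * \<Lambda>\<^sup>2 * (1 / (real j)\<^sup>2)" using n by (simp add: power_mult_distrib)
    finally show ?thesis .
  qed
  have split: "(\<Sum>m\<in>{n..<n * Suc J}. \<bar>?t m\<bar>) = (\<Sum>j=1..J. \<Sum>m\<in>{n * j..<n * Suc j}. \<bar>?t m\<bar>)" for J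
  proof (induction J)
    case (Suc J)
    have "(\<Sum>m\<in>{n..<n * Suc (Suc J)}. \<bar>?t m\<bar>) = (\<Sum>m\<in>{n..<n * Suc J}. \<bar>?t m\<bar>) + (\<Sum>m\<in>{n * Suc J..<n * Suc (Suc J)}. \<bar>?t m\<bar>)"
      by (rule sum.atLeastLessThan_concat[symmetric]) auto
    with Suc show ?case by simp
  qed simp
  have "\<bar>\<Sum>m\<in>{n..<n * Suc J}. ?t m\<bar> \<le> (\<Sum>m\<in>{n..<n * Suc J}. \<bar>?t m\<bar>)" by (rule sum_abs)
  also have "\<dots> \<le> (\<Sum>j=1..J. 13 * \<Lambda>\<^sup>2 * (1 / (real j)\<^sup>2))"
    unfolding split by (intro sum_mono block) auto
  also have "\<dots> = 13 * \<Lambda>\<^sup>2 * (\<Sum>j=1..J. 1 / (real j)\<^sup>2)" by (simp only: sum_distrib_left)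
  also have "\<dots> \<le> 13 * \<Lambda>\<^sup>2 * 2" by (intro mult_left_mono sum_inverse_squares_le_2) auto
  finally show ?thesis by simp
qed

section \<open>The discrepancy estimate and its asymptotic form\<close>

proposition discrepancy_estimate:
  assumes irr: "\<alpha> \<notin> \<rat>" and n: "1 \<le> n" and \<Lambda>: "1 \<le> \<Lambda>"
    and low: "\<And>h. 1 \<le> h \<Longrightarrow> h \<le> 2 * n \<Longrightarrow> 1 / (real h * \<Lambda>) \<le> dist_nearest_int (real h * \<alpha>)"
  shows "\<bar>L2_discrepancy_sq (sym_points n \<alpha>)
      - (\<Sum>m=1..n. 1 / (4 * pi ^ 4 * (real m)\<^sup>2 * (dist_nearest_int (real m * \<alpha>))\<^sup>2))\<bar>
    \<le> 120 * \<Lambda>\<^sup>2 * (1 + ln \<Lambda>)"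
proof -
  let ?V = "\<lambda>m. mean_kernel n (real m * \<alpha>)"
  let ?t = "\<lambda>m. (?V (Suc m) - 1) / (2 * pi\<^sup>2 * (real (Suc m))\<^sup>2)"
  let ?w = "\<lambda>m. dist_nearest_int (real m * \<alpha>)"
  let ?s = "\<lambda>m. 1 / (4 * pi ^ 4 * (real m)\<^sup>2 * (?w m)\<^sup>2)"
  let ?D = "L2_discrepancy_sq (sym_points n \<alpha>) - 4 / 9"
  have n0: "0 < n" using n by simp
  have sums: "?t sums ?D"
  proof -
    have "2 * pi * real (Suc m) * (real k * \<alpha>) = 2 * pi * (real k * (real (Suc m) * \<alpha>))" for m k
      by (simp add: mult_ac)
    then show ?thesis using L2_discrepancy_fourier[OF irr n0] unfolding mean_kernel_def by (simp only:)
  qed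
  \<comment> \<open>The series is known to converge, so its limit may be taken along the partial
    sums of lengths n(J+1), where whole blocks are summed.\<close>
  have tail: "\<bar>?D - (\<Sum>m<n. ?t m)\<bar> \<le> 26 * \<Lambda>\<^sup>2"
  proof (rule LIMSEQ_le_const2)
    have "(\<lambda>N. \<Sum>m<N. ?t m) \<longlonglongrightarrow> ?D" using sums by (simp add: sums_def)
    moreover have "strict_mono (\<lambda>J. n * Suc J)" using n0 by (intro strict_monoI) simp
    ultimately have "(\<lambda>J. \<Sum>m<n * Suc J. ?t m) \<longlonglongrightarrow> ?D"
      using LIMSEQ_subseq_LIMSEQ[of "\<lambda>N. \<Sum>m<N. ?t m" ?D "\<lambda>J. n * Suc J"] by (simp add: o_def)
    then show "(\<lambda>J. \<bar>(\<Sum>m<n * Suc J. ?t m) - (\<Sum>m<n. ?t m)\<bar>) \<longlonglongrightarrow> \<bar>?D - (\<Sum>m<n. ?t m)\<bar>"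
      by (intro tendsto_rabs tendsto_diff tendsto_const)
    have "\<bar>(\<Sum>m<n * Suc J. ?t m) - (\<Sum>m<n. ?t m)\<bar> \<le> 26 * \<Lambda>\<^sup>2" for J
    proof -
      have "(\<Sum>m<n * Suc J. ?t m) = (\<Sum>m<n. ?t m) + (\<Sum>m\<in>{n..<n * Suc J}. ?t m)"
        unfolding lessThan_atLeast0 by (rule sum.atLeastLessThan_concat[symmetric]) auto
      then show ?thesis using sum_tail_blocks[OF irr n \<Lambda> low, of J] by simp
    qed
    then show "\<exists>N. \<forall>J\<ge>N. \<bar>(\<Sum>m<n * Suc J. ?t m) - (\<Sum>m<n. ?t m)\<bar> \<le> 26 * \<Lambda>\<^sup>2" by blast
  qed
  have shift: "(\<Sum>m<n. ?t m) = (\<Sum>m=1..n. (?V m - 1) / (2 * pi\<^sup>2 * (real m)\<^sup>2))"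
    using sum.atLeast1_atMost_eq[of "\<lambda>m. (?V m - 1) / (2 * pi\<^sup>2 * (real m)\<^sup>2)" n] by simp
  have head_term: "\<bar>(?V m - 1) / (2 * pi\<^sup>2 * (real m)\<^sup>2) - ?s m\<bar>
      \<le> 1 / (real m)\<^sup>2 + 1 / ((real m)\<^sup>2 * (?w m)\<^sup>2) * min 1 (1 / (real n * ?w m))" if m: "m \<in> {1..n}" for m
  proof -
    have x: "real m * \<alpha> \<notin> \<int>" using m irr by (intro int_mult_irrational_notin_Ints) auto
    have w: "0 < ?w m" by (rule dist_nearest_int_pos[OF x])
    have m0: "0 < real m" using m by simp
    let ?e = "1 / (?w m)\<^sup>2 * min 1 (1 / (real n * ?w m))"
    have e0: "0 \<le> ?e" using w by simp
    have "(?V m - 1) / (2 * pi\<^sup>2 * (real m)\<^sup>2) - ?s m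
        = (?V m - 1 / (2 * pi\<^sup>2 * (?w m)\<^sup>2) - 1) / (2 * pi\<^sup>2 * (real m)\<^sup>2)"
      using w m0 by (simp add: field_simps power4_eq_xxxx power2_eq_square)
    also have "\<bar>\<dots>\<bar> = \<bar>?V m - 1 / (2 * pi\<^sup>2 * (?w m)\<^sup>2) - 1\<bar> / (2 * pi\<^sup>2 * (real m)\<^sup>2)" by simp
    \<comment> \<open>The error 11 of the kernel and the -1 of the coefficient make 12, which 2 pi^2
      \<ge> 12 then cancels.\<close>
    also have "\<dots> \<le> (12 + ?e) / (2 * pi\<^sup>2 * (real m)\<^sup>2)"
      using mean_kernel_asymp[OF x n0] by (intro divide_right_mono) (linarith, simp)
    also have "\<dots> \<le> (12 + ?e) / (12 * (real m)\<^sup>2)"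
    proof (intro divide_left_mono mult_right_mono)
      have "3\<^sup>2 \<le> pi\<^sup>2" using pi_gt3 by (intro power_mono) auto
      then show "12 \<le> 2 * pi\<^sup>2" by simp
    qed (use e0 m0 in auto)
    also have "\<dots> = 1 / (real m)\<^sup>2 + ?e / (12 * (real m)\<^sup>2)" by (simp add: add_divide_distrib)
    also have "?e / (12 * (real m)\<^sup>2) \<le> ?e / (1 * (real m)\<^sup>2)"
      using e0 m0 by (intro divide_left_mono mult_right_mono) auto
    also have "?e / (1 * (real m)\<^sup>2) = 1 / ((real m)\<^sup>2 * (?w m)\<^sup>2) * min 1 (1 / (real n * ?w m))"
      by (simp add: mult.commute)
    finally show ?thesis by simp
  qed
  have "\<bar>(\<Sum>m<n. ?t m) - (\<Sum>m=1..n. ?s m)\<bar> = \<bar>\<Sum>m=1..n. (?V m - 1) / (2 * pi\<^sup>2 * (real m)\<^sup>2) - ?s m\<bar>"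
    unfolding shift by (simp only: sum_subtractf)
  also have "\<dots> \<le> (\<Sum>m=1..n. \<bar>(?V m - 1) / (2 * pi\<^sup>2 * (real m)\<^sup>2) - ?s m\<bar>)" by (rule sum_abs)
  also have "\<dots> \<le> (\<Sum>m=1..n. 1 / (real m)\<^sup>2 + 1 / ((real m)\<^sup>2 * (?w m)\<^sup>2) * min 1 (1 / (real n * ?w m)))"
    by (intro sum_mono head_term)
  also have "\<dots> = (\<Sum>m=1..n. 1 / (real m)\<^sup>2) + (\<Sum>m=1..n. 1 / ((real m)\<^sup>2 * (?w m)\<^sup>2) * min 1 (1 / (real n * ?w m)))"
    by (rule sum.distrib)
  also have "\<dots> \<le> 2 + 12 * \<Lambda>\<^sup>2 * (2 * ln \<Lambda> + 5)"
    using n \<Lambda> low by (intro add_mono sum_inverse_squares_le_2 sum_head_error) auto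
  finally have head: "\<bar>(\<Sum>m<n. ?t m) - (\<Sum>m=1..n. ?s m)\<bar> \<le> 2 + 12 * \<Lambda>\<^sup>2 * (2 * ln \<Lambda> + 5)" .
  \<comment> \<open>Head, tail and the constant 4/9 are all absorbed by multiples of \<Lambda>^2 and
    \<Lambda>^2 ln \<Lambda>.\<close>
  have "1 \<le> \<Lambda>\<^sup>2" using \<Lambda> by (simp add: one_le_power)
  moreover have "0 \<le> \<Lambda>\<^sup>2 * ln \<Lambda>" using \<Lambda> by simp
  moreover have "12 * \<Lambda>\<^sup>2 * (2 * ln \<Lambda> + 5) = 24 * (\<Lambda>\<^sup>2 * ln \<Lambda>) + 60 * \<Lambda>\<^sup>2"
    "120 * \<Lambda>\<^sup>2 * (1 + ln \<Lambda>) = 120 * (\<Lambda>\<^sup>2 * ln \<Lambda>) + 120 * \<Lambda>\<^sup>2" by (simp_all add: algebra_simps)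
  ultimately show ?thesis using head tail by linarith
qed

text \<open>For h \<le> 2n the index of the relevant partial quotient is O(log n), so the growth
  condition bounds that quotient by a constant times log^d n. Taking n \<ge> 3 ensures ln n \<ge>
  1.\<close>

lemma dist_nearest_int_lower_bound:
  assumes irr: "\<alpha> \<notin> \<rat>" and d: "0 \<le> d"
    and pq: "(\<lambda>k. real_of_int (partial_quotient \<alpha> k)) \<in> O(\<lambda>k. real k powr d)"
  obtains C where "1 \<le> C"
    "\<And>n h. \<lbrakk>3 \<le> n; 1 \<le> h; h \<le> 2 * n\<rbrakk> \<Longrightarrow> 1 / (real h * (C * ln (real n) powr d)) \<le> dist_nearest_int (real h * \<alpha>)"
proof -
  obtain c where c: "0 < c" "eventually (\<lambda>k. norm (real_of_int (partial_quotient \<alpha> k)) \<le> c * norm (real k powr d)) at_top"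
    using landau_o.bigE[OF pq] by blast
  then obtain k0 where k0: "\<And>k. k0 \<le> k \<Longrightarrow> real_of_int (partial_quotient \<alpha> k) \<le> c * real k powr d"
    unfolding eventually_at_top_linorder by (auto, metis abs_le_D1)
  \<comment> \<open>The finitely many quotients below \<open>k0\<close> are added to the constant,
    so the bound holds from index 1 on; at index 0 it could fail, as \<open>0 powr d\<close> is
    0.\<close>
  define B where "B = c + (\<Sum>k<k0. \<bar>real_of_int (partial_quotient \<alpha> k)\<bar>)"
  have B: "c \<le> B" by (simp add: B_def sum_nonneg)
  have a: "real_of_int (partial_quotient \<alpha> (Suc k)) \<le> B * real (Suc k) powr d" for k
  proof (cases "k0 \<le> Suc k")
    case True
    have "real_of_int (partial_quotient \<alpha> (Suc k)) \<le> c * real (Suc k) powr d" by (rule k0[OF True])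
    also have "\<dots> \<le> B * real (Suc k) powr d" using B by (intro mult_right_mono) auto
    finally show ?thesis .
  next
    case False
    then have "\<bar>real_of_int (partial_quotient \<alpha> (Suc k))\<bar> \<le> (\<Sum>k<k0. \<bar>real_of_int (partial_quotient \<alpha> k)\<bar>)"
      by (intro member_le_sum) auto
    then have "real_of_int (partial_quotient \<alpha> (Suc k)) \<le> B * 1" using c(1) by (simp add: B_def)
    also have "\<dots> \<le> B * real (Suc k) powr d"
      using B c(1) d by (intro mult_left_mono ge_one_powr_ge_zero) auto
    finally show ?thesis .
  qed
  \<comment> \<open>From 2^k \<le> 8 n^2 and ln 2 \<ge> 1/2 follows k + 1 \<le> 4 + 4 ln n \<le> 8
    ln n, whence \<open>8 powr d\<close>; the rest comes from the denominator 2 (a + 1) h.\<close>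
  define C where "C = 2 * (B * 8 powr d + 1)"
  have C: "1 \<le> C" using B c(1) by (simp add: C_def)
  show ?thesis
  proof (rule that[OF C])
    fix n h :: nat assume n: "3 \<le> n" and h: "1 \<le> h" "h \<le> 2 * n"
    define L where "L = ln (real n)"
    have L1: "1 \<le> L"
    proof -
      have "exp 1 \<le> real n" using exp_le n by linarith
      then show ?thesis using n by (simp add: L_def ln_ge_iff)
    qed
    obtain k where k: "2 ^ k \<le> 2 * (real h)\<^sup>2"
      "1 / (2 * (of_int (partial_quotient \<alpha> (Suc k)) + 1) * real h) \<le> dist_nearest_int (real h * \<alpha>)"
      using dist_nearest_int_ge_partial_quotient[OF irr h(1)] by blast
    have "2 ^ k \<le> 2 * (real h)\<^sup>2" by (rule k(1))
    also have "\<dots> \<le> 2 * (2 * real n)\<^sup>2" using h by (intro mult_left_mono power_mono) auto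
    also have "\<dots> = 2 ^ 3 * (real n)\<^sup>2" by (simp add: power_mult_distrib)
    finally have "ln (2 ^ k) \<le> ln (2 ^ 3 * (real n)\<^sup>2)" using n by (subst ln_le_cancel_iff) auto
    then have "real k * ln 2 \<le> 3 * ln 2 + 2 * L"
      using n ln_mult[of "2 ^ 3" "(real n)\<^sup>2"] ln_realpow[of 2 3] ln_realpow[of 2 k] ln_realpow[of "real n" 2]
      by (simp add: L_def)
    moreover have "L * (1 / 2) \<le> L * ln 2" using ln2_ge_two_thirds L1 by (intro mult_left_mono) auto
    ultimately have "real k * ln 2 \<le> (3 + 4 * L) * ln 2" unfolding distrib_right by linarith
    then have "real k \<le> 3 + 4 * L" by simp
    then have k8: "real (Suc k) \<le> 8 * L" using L1 by simp
    have "real_of_int (partial_quotient \<alpha> (Suc k)) \<le> B * real (Suc k) powr d" by (rule a)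
    also have "\<dots> \<le> B * (8 * L) powr d"
      using k8 B c(1) d by (intro mult_left_mono powr_mono2) auto
    also have "\<dots> = B * 8 powr d * L powr d" using L1 by (simp add: powr_mult)
    finally have "real_of_int (partial_quotient \<alpha> (Suc k)) + 1 \<le> B * 8 powr d * L powr d + 1 * L powr d"
      using L1 d by (intro add_mono) (auto simp: ge_one_powr_ge_zero)
    then have "2 * (real_of_int (partial_quotient \<alpha> (Suc k)) + 1) \<le> C * L powr d"
      unfolding C_def by (simp add: algebra_simps)
    then have "2 * (real_of_int (partial_quotient \<alpha> (Suc k)) + 1) * real h \<le> C * L powr d * real h"
      by (intro mult_right_mono) auto
    moreover have "0 < 2 * (real_of_int (partial_quotient \<alpha> (Suc k)) + 1) * real h"
      using partial_quotient_ge_1[OF irr, of k] h by (intro mult_pos_pos) auto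
    ultimately have "1 / (C * L powr d * real h) \<le> 1 / (2 * (real_of_int (partial_quotient \<alpha> (Suc k)) + 1) * real h)"
      by (intro frac_le) linarith+
    also note k(2)
    finally show "1 / (real h * (C * ln (real n) powr d)) \<le> dist_nearest_int (real h * \<alpha>)"
      by (simp add: L_def mult_ac)
  qed
qed

theorem theorem1:
  fixes \<alpha> d :: real
  assumes "\<alpha> \<notin> \<rat>"
    and "d \<ge> 0"
    and "(\<lambda>k. real_of_int (partial_quotient \<alpha> k)) \<in> O(\<lambda>k. real k powr d)"
  shows "(\<lambda>n. L2_discrepancy_sq (sym_points n \<alpha>)
              - (\<Sum>m=1..n. 1 / (4 * pi ^ 4 * (real m)\<^sup>2 * (dist_nearest_int (real m * \<alpha>))\<^sup>2)))
         \<in> O(\<lambda>n. ln (real n) powr (2 * d) * ln (ln (real n)))"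
proof -
  obtain C where C: "1 \<le> C"
    "\<And>n h. \<lbrakk>3 \<le> n; 1 \<le> h; h \<le> 2 * n\<rbrakk> \<Longrightarrow> 1 / (real h * (C * ln (real n) powr d)) \<le> dist_nearest_int (real h * \<alpha>)"
    using dist_nearest_int_lower_bound[OF assms] by blast
  \<comment> \<open>Past this threshold ln ln n \<ge> 1, so it absorbs constants.\<close>
  have "eventually (\<lambda>n. exp (exp 1) \<le> real n) at_top" by (rule eventually_compose_filterlim[OF eventually_ge_at_top filterlim_real_sequentially])
  then have "eventually (\<lambda>n. norm (L2_discrepancy_sq (sym_points n \<alpha>)
              - (\<Sum>m=1..n. 1 / (4 * pi ^ 4 * (real m)\<^sup>2 * (dist_nearest_int (real m * \<alpha>))\<^sup>2)))
      \<le> 120 * C\<^sup>2 * (1 + ln C + d) * norm (ln (real n) powr (2 * d) * ln (ln (real n)))) at_top"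
    using eventually_ge_at_top[of 3]
  proof eventually_elim
    case (elim n)
    define L where "L = ln (real n)"
    define \<Lambda> where "\<Lambda> = C * L powr d"
    have L: "exp 1 \<le> L" using elim by (simp add: L_def ln_ge_iff)
    have e1: "(1::real) \<le> exp 1" by simp
    have L1: "1 \<le> L" using L e1 by linarith
    have LL: "1 \<le> ln L" using L L1 by (simp add: ln_ge_iff)
    have "1 * 1 \<le> C * L powr d" using C(1) L1 assms(2) by (intro mult_mono ge_one_powr_ge_zero) auto
    then have \<Lambda>: "1 \<le> \<Lambda>" by (simp add: \<Lambda>_def)
    have "\<bar>L2_discrepancy_sq (sym_points n \<alpha>)
              - (\<Sum>m=1..n. 1 / (4 * pi ^ 4 * (real m)\<^sup>2 * (dist_nearest_int (real m * \<alpha>))\<^sup>2))\<bar>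
        \<le> 120 * \<Lambda>\<^sup>2 * (1 + ln \<Lambda>)"
      using elim C(2)[of n] unfolding \<Lambda>_def L_def
      by (intro discrepancy_estimate assms \<Lambda>[unfolded \<Lambda>_def L_def]) auto
    also have "\<dots> \<le> 120 * \<Lambda>\<^sup>2 * ((1 + ln C + d) * ln L)"
    proof (intro mult_left_mono)
      \<comment> \<open>This logarithm of \<Lambda> is the source of the factor log log n.\<close>
      have "ln \<Lambda> = ln C + d * ln L" using C(1) L1 by (simp add: \<Lambda>_def ln_mult)
      moreover have "1 * (1 + ln C) \<le> ln L * (1 + ln C)" using LL C(1) by (intro mult_right_mono) auto
      ultimately show "1 + ln \<Lambda> \<le> (1 + ln C + d) * ln L" by (simp add: algebra_simps)
    qed simp
    also have "\<dots> = 120 * C\<^sup>2 * (1 + ln C + d) * norm (L powr (2 * d) * ln L)"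
    proof -
      have "(L powr d)\<^sup>2 = L powr (2 * d)" by (simp only: mult_2 powr_add power2_eq_square)
      then have "\<Lambda>\<^sup>2 = C\<^sup>2 * L powr (2 * d)" by (simp add: \<Lambda>_def power_mult_distrib)
      then show ?thesis using LL by (simp add: abs_mult)
    qed
    finally show ?case by (simp only: L_def real_norm_def)
  qed
  then show ?thesis by (rule bigoI)
qed

end
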